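(* Let $\beta\ge2$ be an integer, let $p_0,\dots,p_{\beta-1}>0$ with $p_0+\dots+p_{\beta-1}=1$, let $S$ be the one-sided full $\beta$-shift on $\Sigma_+=\{0,\dots,\beta-1\}^{\mathbb{N}}$ with the Bernoulli measure $\mu_+$ of weights $(p_i)$, let $V_S$ be its Perron-Frobenius operator on $L^2(\Sigma_+,\mu_+)$, and let $[\beta]=\{0,1,\dots,\beta-1\}$, $X=\mathbb{C}[h]$, $\Phi_i,\Phi_i'$, $U_S^\times$ be as defined in the context. Then: (1) The resolvent $(\lambda-V_S)^{-1}$ has an analytic continuation to the inside of the unit circle as an operator from $X$ into $X'$. The generalized eigenvalues with respect to the Gelfand triplet $X\subset L^2(\Sigma_+,\mu_+)\subset X'$ are given by $\{\sum_{i\in[\beta]}p_i^{n+1}\}_{n\ge0}$. (2) $V_S$ and $U_S^\times$ have spectral decompositions of the form $$V_Sf=\sum_{i=0}^\infty\Big(\sum_{n\in[\beta]}p_n^{i+1}\Big)\overline{\langle\Phi_i'\,|\,f\rangle}\,\Phi_i,\quad f\in X,$$ $$U_S^\times\mu=\sum_{i=0}^\infty\Big(\sum_{n\in[\beta]}p_n^{i+1}\Big)\langle\mu\,|\,\Phi_i\rangle\,\Phi_i',\quad\mu\in X'.$$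
   Context: Setting: $[\beta]=\{0,\dots,\beta-1\}$; $\Sigma_+=[\beta]^{\mathbb{N}}$ has elements $\omega=(\omega_1,\omega_2,\dots)$; $(S\omega)_j=\omega_{j+1}$; $\mu_+=\mu_0^{\otimes\mathbb{N}}$ with $\mu_0(\{i\})=p_i$. The Koopman operator on $L^2(\Sigma_+,\mu_+)$ is $(U_Sf)(\omega)=f(S\omega)$, and the Perron-Frobenius operator is $V_S=U_S^*$. Inner products are linear in the first variable. Test space: for $n\ge1$ let $N_n^k(\omega)=\#\{i\in\{1,\dots,n-1\}:\omega_i=k\}$ (so $N_1^k=0$), and $$h(\omega)=\sum_{n\ge1,\ \omega_n\ne0}(p_0+\dots+p_{\omega_n-1})\,p_0^{N_n^0(\omega)}\cdots p_{\beta-1}^{N_n^{\beta-1}(\omega)}\in[0,1].$$ $X_n=\sum_{i=0}^n\mathbb{C}h^i$ (dimension $n+1$, usual topology), $X=\varinjlim X_n=\mathbb{C}[h]$ with the inductive limit topology, a dense subspace of $L^2(\Sigma_+,\mu_+)$ with a stronger topology. $V_S$ maps $X_n$ to $X_n$ and is continuous on $X$. Duality: $X'$ is the space of continuous anti-linear functionals on $X$ with the weak* topology; $\mu(f)$ is written $\langle\mu|f\rangle$ (linear in $\mu$, anti-linear in $f$). $L^2(\Sigma_+,\mu_+)\subset X'$ via $g\mapsto(g,\cdot)$. Infinite series in $X'$ converge in the weak* topology. $\Phi_n\in X_n$ is the unique eigenvector of $V_S|_X$ with eigenvalue $\sum_{i\in[\beta]}p_i^{n+1}$ that is a monic polynomial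 in $h$ of degree $n$; these form a basis of $X$. $\{\Phi_n'\}\subset X'$ is the dual basis, $\langle\Phi_i'|\Phi_j\rangle=\delta_{i,j}$. $U_S^\times:X'\to X'$ is defined by $\langle U_S^\times\mu|f\rangle=\langle\mu|V_Sf\rangle$ for $f\in X$, $\mu\in X'$. Generalized spectrum: for $f\in X$ the map $\lambda\mapsto(\lambda-V_S)^{-1}f\in L^2(\Sigma_+,\mu_+)\subset X'$ is holomorphic for $|\lambda|>1$. The resolvent has an analytic continuation as an operator from $X$ into $X'$ if, for every $f\in X$, this $X'$-valued function continues analytically (weak* sense) from $|\lambda|>1$ across the unit circle to its inside, outside a set of singularities; the continuation $R_\lambda:X\to X'$ is the generalized resolvent, and the set of its singularities is the generalized spectrum. For an isolated singularity $\lambda_0$, the Riesz projection is $\Pi_{\lambda_0}f=\frac1{2\pi i}\oint_C R_zf\,dz$ ($C$ a positively oriented closed curve encircling $\lambda_0$ and no other singularity), an operator from $X$ into $X'$. Such a $\lambda_0$ is a generalized eigenvalue if it has associated eigenvectors in $X'$; the generalized eigenspace is the image of $\Pi_{\lambda_0}$ and its nonzero elements are the generalized eigenvectors. *)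

theory Defs
  imports "HOL-Probability.Probability" "HOL-Complex_Analysis.Complex_Analysis"
begin

text \<open>
  Sequences are indexed from 0: \<open>\<omega> j\<close> is the coordinate with index \<open>j + 1\<close> of the 1-based convention.
  Elements of \<open>L\<^sup>2\<close> are represented by functions; equality in \<open>L\<^sup>2\<close> is equality almost everywhere.
\<close>

type_synonym sq = "nat \<Rightarrow> nat"
type_synonym obs = "sq \<Rightarrow> complex"
type_synonym functional = "obs \<Rightarrow> complex"

definition lshift :: "sq \<Rightarrow> sq" where
  "lshift \<omega> = (\<lambda>j. \<omega> (Suc j))"

definition koopman :: "obs \<Rightarrow> obs" where
  "koopman f = (\<lambda>\<omega>. f (lshift \<omega>))"

context
  fixes \<beta> :: nat and p :: "nat \<Rightarrow> real"
begin

definition bernoulli_measure :: "sq measure" where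
  "bernoulli_measure = (\<Pi>\<^sub>M j\<in>(UNIV :: nat set). point_measure {..<\<beta>} (\<lambda>i. ennreal (p i)))"

definition L2 :: "obs set" where
  "L2 = {f \<in> borel_measurable bernoulli_measure.
           integrable bernoulli_measure (\<lambda>\<omega>. (cmod (f \<omega>))\<^sup>2)}"

definition L2_inner :: "obs \<Rightarrow> obs \<Rightarrow> complex" where
  "L2_inner f g = (\<integral>\<omega>. f \<omega> * cnj (g \<omega>) \<partial>bernoulli_measure)"

text \<open>The Hilbert space adjoint of the Koopman operator; the chosen representative is determined
  up to equality almost everywhere.\<close>

definition perron_frobenius :: "obs \<Rightarrow> obs" where
  "perron_frobenius f =
     (SOME g. g \<in> L2 \<and> (\<forall>k\<in>L2. L2_inner g k = L2_inner f (koopman k)))"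

text \<open>Again determined up to equality almost everywhere whenever \<open>z - V\<^sub>S\<close> is bijective
  on \<open>L\<^sup>2\<close>, in particular for \<open>cmod z > 1\<close>; it is only used there.\<close>

definition L2_resolvent :: "complex \<Rightarrow> obs \<Rightarrow> obs" where
  "L2_resolvent z f =
     (SOME g. g \<in> L2 \<and> (AE \<omega> in bernoulli_measure. z * g \<omega> - perron_frobenius g \<omega> = f \<omega>))"

definition h_fun :: "sq \<Rightarrow> real" where
  "h_fun \<omega> = (\<Sum>n. if \<omega> n \<noteq> 0
      then (\<Sum>j<\<omega> n. p j) * (\<Prod>k<\<beta>. p k ^ card {i. i < n \<and> \<omega> i = k}) else 0)"

definition h_poly :: "(nat \<Rightarrow> complex) \<Rightarrow> nat \<Rightarrow> obs" where
  "h_poly c n = (\<lambda>\<omega>. \<Sum>i\<le>n. c i * complex_of_real (h_fun \<omega>) ^ i)"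

definition X_n :: "nat \<Rightarrow> obs set" where
  "X_n n = {h_poly c n | c. True}"

definition X :: "obs set" where
  "X = (\<Union>n. X_n n)"

text \<open>Each \<open>X_n n\<close> is finite-dimensional, so its usual topology is the one inherited from the
  (Hausdorff) product topology on the function type. \<open>X\<close> carries the final topology with
  respect to the inclusions \<open>X_n n \<subseteq> X\<close>; for an increasing sequence of finite-dimensional spaces
  this is also the locally convex inductive limit topology.\<close>

definition X_topology :: "obs topology" where
  "X_topology = topology (\<lambda>U. U \<subseteq> X \<and> (\<forall>n. openin (top_of_set (X_n n)) (U \<inter> X_n n)))"

lemma openin_X_topology:
  "openin X_topology U \<longleftrightarrow> U \<subseteq> X \<and> (\<forall>n. openin (top_of_set (X_n n)) (U \<inter> X_n n))"
proof -
  have "istopology (\<lambda>U. U \<subseteq> X \<and> (\<forall>n. openin (top_of_set (X_n n)) (U \<inter> X_n n)))"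
    unfolding istopology_def
  proof (intro conjI allI impI)
    fix U V n
    assume "U \<subseteq> X \<and> (\<forall>n. openin (top_of_set (X_n n)) (U \<inter> X_n n))"
       and "V \<subseteq> X \<and> (\<forall>n. openin (top_of_set (X_n n)) (V \<inter> X_n n))"
    then have "openin (top_of_set (X_n n)) ((U \<inter> X_n n) \<inter> (V \<inter> X_n n))"
      by blast
    then show "openin (top_of_set (X_n n)) (U \<inter> V \<inter> X_n n)"
      by (simp add: inf.assoc inf.left_commute)
  next
    fix K n
    assume "\<forall>U\<in>K. U \<subseteq> X \<and> (\<forall>n. openin (top_of_set (X_n n)) (U \<inter> X_n n))"
    then have "openin (top_of_set (X_n n)) (\<Union>((\<lambda>U. U \<inter> X_n n) ` K))"
      by (intro openin_Union) auto
    then show "openin (top_of_set (X_n n)) (\<Union> K \<inter> X_n n)"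
      by (simp add: Int_commute Int_Union)
  qed auto
  then show ?thesis
    by (simp add: X_topology_def topology_inverse')
qed

text \<open>The dual of continuous anti-linear functionals; functionals are made total by
  extensionality outside \<open>X\<close>, and the weak* topology is the topology of pointwise
  convergence on \<open>X\<close>.\<close>

definition X_dual :: "functional set" where
  "X_dual = {\<mu> \<in> extensional X. continuous_map X_topology euclidean \<mu> \<and>
     (\<forall>f\<in>X. \<forall>g\<in>X. \<mu> (\<lambda>\<omega>. f \<omega> + g \<omega>) = \<mu> f + \<mu> g) \<and>
     (\<forall>a. \<forall>f\<in>X. \<mu> (\<lambda>\<omega>. a * f \<omega>) = cnj a * \<mu> f)}"

definition weak_star :: "functional topology" where
  "weak_star = subtopology (product_topology (\<lambda>_. euclidean) X) X_dual"

definition L2_embed :: "obs \<Rightarrow> functional" where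
  "L2_embed g = (\<lambda>f\<in>X. L2_inner g f)"

text \<open>The restriction of the Perron-Frobenius operator to \<open>X\<close>: the polynomial in \<open>h_fun\<close>
  representing the \<open>L\<^sup>2\<close>-class.\<close>

definition V_X :: "obs \<Rightarrow> obs" where
  "V_X f = (THE g. g \<in> X \<and> (AE \<omega> in bernoulli_measure. g \<omega> = perron_frobenius f \<omega>))"

definition U_cross :: "functional \<Rightarrow> functional" where
  "U_cross \<mu> = (\<lambda>f\<in>X. \<mu> (V_X f))"

definition Phi :: "nat \<Rightarrow> obs" where
  "Phi n = (THE f. (\<exists>c. c n = 1 \<and> f = h_poly c n) \<and>
              V_X f = (\<lambda>\<omega>. complex_of_real (\<Sum>i<\<beta>. p i ^ (n + 1)) * f \<omega>))"

definition Phi_dual :: "nat \<Rightarrow> functional" where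
  "Phi_dual i = (THE \<mu>. \<mu> \<in> X_dual \<and> (\<forall>j. \<mu> (Phi j) = (if i = j then 1 else 0)))"

definition weakly_holomorphic_on :: "(complex \<Rightarrow> obs \<Rightarrow> functional) \<Rightarrow> complex set \<Rightarrow> bool" where
  "weakly_holomorphic_on R D \<longleftrightarrow>
     (\<forall>z\<in>D. \<forall>f\<in>X. R z f \<in> X_dual) \<and>
     (\<forall>f\<in>X. \<forall>\<phi>\<in>X. (\<lambda>z. R z f \<phi>) holomorphic_on D)"

text \<open>\<open>R\<close> is the analytic continuation of the resolvent and \<open>S\<close> its set of singularities, i.e.
  the points around which \<open>R\<close> does not extend as an operator from \<open>X\<close> into its dual.
  At interior points of \<open>S\<close> an extension would exist vacuously, so the last clause forces
  \<open>S\<close> to have empty interior: the continuation crosses the unit circle and fills the disc up to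
  singularities. As \<open>- S\<close> is connected, linearity of \<open>R z\<close> is inherited from the resolvent.\<close>

definition generalized_resolvent :: "(complex \<Rightarrow> obs \<Rightarrow> functional) \<Rightarrow> complex set \<Rightarrow> bool" where
  "generalized_resolvent R S \<longleftrightarrow>
     closed S \<and> S \<subseteq> cball 0 1 \<and> connected (- S) \<and>
     weakly_holomorphic_on R (- S) \<and>
     (\<forall>z. cmod z > 1 \<longrightarrow> (\<forall>f\<in>X. R z f = L2_embed (L2_resolvent z f))) \<and>
     (\<forall>s\<in>S. \<not> (\<exists>r>0. \<exists>F. weakly_holomorphic_on F (ball s r) \<and>
                 (\<forall>z\<in>ball s r - S. \<forall>f\<in>X. F z f = R z f)))"

definition encircles_only :: "(real \<Rightarrow> complex) \<Rightarrow> complex set \<Rightarrow> complex \<Rightarrow> bool" where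
  "encircles_only \<gamma> S z0 \<longleftrightarrow>
     valid_path \<gamma> \<and> simple_path \<gamma> \<and> pathfinish \<gamma> = pathstart \<gamma> \<and> path_image \<gamma> \<subseteq> - S \<and>
     winding_number \<gamma> z0 = 1 \<and> (\<forall>s\<in>S - {z0}. winding_number \<gamma> s = 0)"

definition riesz_projection ::
  "(complex \<Rightarrow> obs \<Rightarrow> functional) \<Rightarrow> complex set \<Rightarrow> complex \<Rightarrow> obs \<Rightarrow> functional" where
  "riesz_projection R S z0 f =
     (let \<gamma> = (SOME \<gamma>. encircles_only \<gamma> S z0)
      in (\<lambda>\<phi>\<in>X. 1 / (2 * complex_of_real pi * \<i>) * contour_integral \<gamma> (\<lambda>z. R z f \<phi>)))"

definition generalized_eigenvectors ::
  "(complex \<Rightarrow> obs \<Rightarrow> functional) \<Rightarrow> complex set \<Rightarrow> complex \<Rightarrow> functional set" where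
  "generalized_eigenvectors R S z0 = riesz_projection R S z0 ` X - {\<lambda>\<phi>\<in>X. 0}"

definition generalized_eigenvalues ::
  "(complex \<Rightarrow> obs \<Rightarrow> functional) \<Rightarrow> complex set \<Rightarrow> complex set" where
  "generalized_eigenvalues R S =
     {z0 \<in> S. \<not> z0 islimpt S \<and> generalized_eigenvectors R S z0 \<noteq> {}}"

end

end

theory Submission
  imports Defs
begin

text \<open>
  Conditioning on the first coordinate shows that the Perron--Frobenius operator acts by
  \<open>(V\<^sub>S f)(\<omega>) = \<Sum>\<^sub>i p\<^sub>i f(i\<omega>)\<close>, and \<open>h(i\<omega>) = (p\<^sub>0 + \<dots> + p\<^bsub>i-1\<^esub>) + p\<^sub>i h(\<omega>)\<close>. On polynomials
  in \<open>h\<close> it is therefore \<open>q(x) \<mapsto> \<Sum>\<^sub>i p\<^sub>i q(p\<^sub>0 + \<dots> + p\<^bsub>i-1\<^esub> + p\<^sub>i x)\<close>, which is triangular in the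
  degree with pairwise distinct diagonal entries \<open>\<lambda>\<^sub>n = \<Sum>\<^sub>i p\<^sub>i\<^sup>n\<^sup>+\<^sup>1\<close>; hence its monic eigenpolynomials
  form a basis. The resolvent of an observable is a finite sum \<open>\<Sum>\<^sub>i c\<^sub>i / (z - \<lambda>\<^sub>i) \<Phi>\<^sub>i\<close>, which continues to
  the complement of the eigenvalues and their limit point 0. Each \<open>\<lambda>\<^sub>n\<close> is a genuine pole,
  seen on \<open>f = \<phi> = \<Phi>\<^sub>n\<close> with residue \<open>\<parallel>\<Phi>\<^sub>n\<parallel>\<^sup>2 > 0\<close>, and the identity theorem forces every generalized
  resolvent to agree with this one.
\<close>

subsection \<open>Triangular operators on polynomials\<close>

lemma smult_sum_right: "smult a (\<Sum>i\<in>A. f i) = (\<Sum>i\<in>A. smult a (f i))"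
  by (induction A rule: infinite_finite_induct) (simp_all add: smult_add_right)

text \<open>The condition \<open>coeff_T\<close> also covers \<open>n\<close> above the degree of
  \<open>q\<close>, where it says that \<open>T\<close> does not raise degrees. Distinct diagonal
  entries then make \<open>T\<close> diagonalizable.\<close>

locale triangular_operator =
  fixes T :: "complex poly \<Rightarrow> complex poly" and ev :: "nat \<Rightarrow> complex"
  assumes T_add: "T (q + r) = T q + T r"
    and T_smult: "T (smult a q) = smult a (T q)"
    and coeff_T: "degree q \<le> n \<Longrightarrow> coeff (T q) n = ev n * coeff q n"
    and inj_ev: "inj ev"
begin

lemma T_0 [simp]: "T 0 = 0"
  using T_smult[of 0 0] by simp

lemma T_diff: "T (q - r) = T q - T r"
  using T_add[of "q - r" r] by simp

lemma T_sum: "finite A \<Longrightarrow> T (\<Sum>i\<in>A. f i) = (\<Sum>i\<in>A. T (f i))"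
  by (induction A rule: finite_induct) (auto simp: T_add)

text \<open>Back substitution from the top coefficient: below degree \<open>n\<close> the diagonal
  entries \<open>ev m - ev n\<close> of the shifted operator are nonzero. Vanishing coefficients
  from \<open>m\<close> on express degree below \<open>m\<close> without excluding the zero
  polynomial.\<close>

lemma shifted_surj_below:
  assumes "m \<le> n" and "\<forall>k\<ge>m. coeff r k = 0"
  shows "\<exists>s. (\<forall>k\<ge>m. coeff s k = 0) \<and> T s - smult (ev n) s = r"
  using assms
proof (induction m arbitrary: r)
  case 0
  then have "r = 0" by (simp add: poly_eq_iff)
  then show ?case by (intro exI[of _ 0]) simp
next
  case (Suc m)
  have ne: "ev m - ev n \<noteq> 0"
    using inj_ev Suc.prems(1) by (auto simp: inj_eq)
  \<comment> \<open>The monomial whose image under \<open>T - ev n\<close> has the same coefficient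
    at \<open>m\<close> as \<open>r\<close>; the remainder \<open>r'\<close> is left to the
    induction hypothesis.\<close>
  define t where "t = monom (coeff r m / (ev m - ev n)) m"
  define r' where "r' = r - (T t - smult (ev n) t)"
  have dt: "degree t \<le> m" by (simp add: t_def degree_monom_le)
  have "coeff r' k = 0" if "k \<ge> m" for k
  proof (cases "k = m")
    case True
    have "coeff (T t) m = ev m * coeff t m" using coeff_T[OF dt] .
    then have "coeff r' m = coeff r m - (ev m - ev n) * coeff t m"
      by (simp add: r'_def algebra_simps)
    also have "\<dots> = 0" using ne by (simp add: t_def)
    finally show ?thesis using True by simp
  next
    case False
    then have "k > m" using that by simp
    moreover have "coeff (T t) k = ev k * coeff t k" using coeff_T[of t k] dt \<open>k > m\<close> by simp
    ultimately show ?thesis using Suc.prems(2) dt by (simp add: r'_def coeff_eq_0)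
  qed
  then obtain s where s: "\<forall>k\<ge>m. coeff s k = 0" "T s - smult (ev n) s = r'"
    using Suc.IH[of r'] Suc.prems(1) by auto
  have "\<forall>k\<ge>Suc m. coeff (s + t) k = 0"
    using s(1) dt by (auto simp: coeff_eq_0)
  moreover have "T (s + t) - smult (ev n) (s + t) = r"
    using s(2) by (simp add: T_add r'_def smult_add_right algebra_simps)
  ultimately show ?case by blast
qed

text \<open>Applied to the monomial of degree \<open>n\<close>, the shifted operator leaves an error
  of degree below \<open>n\<close>, which a lower-order correction removes. For uniqueness, the top
  coefficient of a difference of degree \<open>k\<close> forces \<open>ev k = ev n\<close>, but the
  coefficients at \<open>n\<close> cancel.\<close>

lemma eigenpoly_ex1:
  "\<exists>!E. degree E \<le> n \<and> coeff E n = 1 \<and> T E = smult (ev n) E"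
proof (rule ex_ex1I)
  define r where "r = T (monom 1 n) - smult (ev n) (monom 1 n)"
  have "coeff r k = 0" if "k \<ge> n" for k
    using that coeff_T[of "monom 1 n" k] by (simp add: r_def degree_monom_eq)
  then obtain s where s: "\<forall>k\<ge>n. coeff s k = 0" "T s - smult (ev n) s = r"
    using shifted_surj_below[of n n r] by auto
  have "degree (monom 1 n - s) \<le> n"
    by (rule degree_le) (use s(1) in auto)
  moreover have "T (monom 1 n - s) = smult (ev n) (monom 1 n - s)"
    using s(2) by (simp add: r_def T_diff smult_diff_right algebra_simps)
  ultimately show "\<exists>E. degree E \<le> n \<and> coeff E n = 1 \<and> T E = smult (ev n) E"
    using s(1) by (intro exI[of _ "monom 1 n - s"]) auto
next
  fix E F
  assume E: "degree E \<le> n \<and> coeff E n = 1 \<and> T E = smult (ev n) E"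
     and F: "degree F \<le> n \<and> coeff F n = 1 \<and> T F = smult (ev n) F"
  show "E = F"
  proof (rule ccontr)
    assume "E \<noteq> F"
    define d where "d = E - F"
    define k where "k = degree d"
    have d0: "coeff d k \<noteq> 0" using \<open>E \<noteq> F\<close> by (simp add: d_def k_def del: coeff_diff)
    have "T d = smult (ev n) d" using E F by (simp add: d_def T_diff smult_diff_right)
    then have "ev n * coeff d k = ev k * coeff d k"
      using coeff_T[of d k] by (simp add: k_def)
    then have "k = n" using d0 inj_ev by (simp add: inj_eq)
    then show False using d0 E F by (simp add: d_def)
  qed
qed

section \<open>Eigenpolynomials and coordinates in their basis\<close>

definition eigenpoly :: "nat \<Rightarrow> complex poly" where
  "eigenpoly n = (THE E. degree E \<le> n \<and> coeff E n = 1 \<and> T E = smult (ev n) E)"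

lemma eigenpoly:
  "degree (eigenpoly n) \<le> n" "coeff (eigenpoly n) n = 1" "T (eigenpoly n) = smult (ev n) (eigenpoly n)"
  using theI'[OF eigenpoly_ex1[of n]] unfolding eigenpoly_def by blast+

lemma eigenpoly_eqI:
  "degree E \<le> n \<Longrightarrow> coeff E n = 1 \<Longrightarrow> T E = smult (ev n) E \<Longrightarrow> E = eigenpoly n"
  using eigenpoly_ex1[of n] eigenpoly[of n] by blast

lemma eigenpoly_independent:
  assumes "(\<Sum>i\<le>N. smult (a i) (eigenpoly i)) = 0" and "i \<le> N"
  shows "a i = 0"
  using assms
proof (induction N arbitrary: i)
  case 0
  have "coeff (smult (a 0) (eigenpoly 0)) 0 = 0"
    using arg_cong[OF 0(1), of "\<lambda>q. coeff q 0"] by simp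
  then show ?case using 0(2) by (simp add: eigenpoly(2))
next
  case (Suc N)
  have "coeff (eigenpoly i) (Suc N) = 0" if "i \<le> N" for i
    using eigenpoly(1)[of i] that by (simp add: coeff_eq_0)
  then have "coeff (\<Sum>i\<le>Suc N. smult (a i) (eigenpoly i)) (Suc N) = a (Suc N)"
    using eigenpoly(2)[of "Suc N"] by (simp add: coeff_sum)
  then have "a (Suc N) = 0" unfolding Suc.prems(1) by simp
  then show ?case using Suc by (cases "i = Suc N") auto
qed

lemma eigenpoly_span:
  "degree q \<le> N \<Longrightarrow> \<exists>a. q = (\<Sum>i\<le>N. smult (a i) (eigenpoly i))"
proof (induction N arbitrary: q)
  case 0
  have "degree (eigenpoly 0) = 0" using eigenpoly(1)[of 0] by simp
  then have "eigenpoly 0 = [:1:]" using eigenpoly(2)[of 0] by (metis coeff_pCons_0 degree_eq_zeroE)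
  moreover obtain c where "q = [:c:]" using 0 by (metis degree_eq_zeroE le_zero_eq)
  ultimately show ?case by (intro exI[of _ "\<lambda>_. c"]) simp
next
  case (Suc N)
  define r where "r = q - smult (coeff q (Suc N)) (eigenpoly (Suc N))"
  have "degree r \<le> N"
  proof (rule degree_le, intro allI impI)
    fix k assume "N < k"
    then consider "k = Suc N" | "k > Suc N" by linarith
    then show "coeff r k = 0"
      using Suc.prems eigenpoly[of "Suc N"] by cases (auto simp: r_def coeff_eq_0)
  qed
  then obtain a where a: "r = (\<Sum>i\<le>N. smult (a i) (eigenpoly i))" using Suc.IH by blast
  have "q = r + smult (coeff q (Suc N)) (eigenpoly (Suc N))" by (simp add: r_def)
  also have "\<dots> = (\<Sum>i\<le>Suc N. smult ((a(Suc N := coeff q (Suc N))) i) (eigenpoly i))"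
    by (simp add: a)
  finally show ?case by blast
qed

text \<open>Padding with zeros beyond the degree lets one coordinate sequence serve every expansion
  of sufficient length.\<close>

definition coord :: "complex poly \<Rightarrow> nat \<Rightarrow> complex" where
  "coord q = (SOME a. (\<forall>i>degree q. a i = 0) \<and> q = (\<Sum>i\<le>degree q. smult (a i) (eigenpoly i)))"

lemma coord:
  "(\<forall>i>degree q. coord q i = 0) \<and> q = (\<Sum>i\<le>degree q. smult (coord q i) (eigenpoly i))"
proof -
  obtain a where "q = (\<Sum>i\<le>degree q. smult (a i) (eigenpoly i))"
    using eigenpoly_span[of q "degree q"] by auto
  then have "\<exists>a. (\<forall>i>degree q. a i = 0) \<and> q = (\<Sum>i\<le>degree q. smult (a i) (eigenpoly i))"
    by (intro exI[of _ "\<lambda>i. if i \<le> degree q then a i else 0"]) auto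
  from someI_ex[OF this] show ?thesis unfolding coord_def .
qed

lemma coord_eq_0: "degree q < i \<Longrightarrow> coord q i = 0"
  using coord by blast

lemma coord_expand:
  assumes "degree q \<le> N"
  shows "(\<Sum>i\<le>N. smult (coord q i) (eigenpoly i)) = q"
proof -
  have "(\<Sum>i\<le>N. smult (coord q i) (eigenpoly i)) = (\<Sum>i\<le>degree q. smult (coord q i) (eigenpoly i))"
    by (rule sum.mono_neutral_right) (use assms in \<open>auto simp: coord_eq_0\<close>)
  then show ?thesis using coord[of q] by simp
qed

text \<open>Both expansions are stretched to a common length \<open>M\<close> and compared by linear
  independence. Linearity of the coordinates follows from this, although they come from a
  choice.\<close>

lemma coord_sum_eigenpoly:
  "coord (\<Sum>i\<le>N. smult (a i) (eigenpoly i)) i = (if i \<le> N then a i else 0)"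
proof -
  let ?q = "\<Sum>i\<le>N. smult (a i) (eigenpoly i)"
  define M where "M = max i (max N (degree ?q))"
  define b where "b i = (if i \<le> N then a i else 0)" for i
  have "?q = (\<Sum>i\<le>M. smult (b i) (eigenpoly i))"
    unfolding b_def by (rule sum.mono_neutral_cong_left) (auto simp: M_def)
  moreover have "?q = (\<Sum>i\<le>M. smult (coord ?q i) (eigenpoly i))"
    by (rule coord_expand[symmetric]) (simp add: M_def)
  ultimately have "(\<Sum>i\<le>M. smult (coord ?q i - b i) (eigenpoly i)) = 0"
    by (simp add: smult_diff_left sum_subtractf)
  from eigenpoly_independent[OF this, of i] show ?thesis by (simp add: b_def M_def)
qed

lemma coord_eqI:
  assumes "q = (\<Sum>i\<le>N. smult (a i) (eigenpoly i))" "i \<le> N"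
  shows "coord q i = a i"
  using assms coord_sum_eigenpoly by simp

lemma coord_add: "coord (q + r) i = coord q i + coord r i"
proof -
  define N where "N = max i (max (degree q) (degree r))"
  have "q + r = (\<Sum>i\<le>N. smult (coord q i + coord r i) (eigenpoly i))"
    by (simp add: smult_add_left sum.distrib coord_expand N_def)
  from coord_eqI[OF this, of i] show ?thesis by (simp add: N_def)
qed

lemma coord_smult: "coord (smult c q) i = c * coord q i"
proof -
  define N where "N = max i (degree q)"
  have "smult c q = smult c (\<Sum>i\<le>N. smult (coord q i) (eigenpoly i))"
    by (simp add: coord_expand N_def)
  also have "\<dots> = (\<Sum>i\<le>N. smult (c * coord q i) (eigenpoly i))"
    by (simp add: smult_sum_right)
  finally show ?thesis using coord_eqI[of "smult c q" "\<lambda>i. c * coord q i" N i] by (simp add: N_def)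
qed

lemma coord_eigenpoly: "coord (eigenpoly j) i = (if i = j then 1 else 0)"
proof -
  have "eigenpoly j = (\<Sum>i\<le>max i j. smult (if i = j then 1 else 0) (eigenpoly i))"
    by (simp add: if_distrib[of "\<lambda>c. smult c _"] cong: if_cong)
  from coord_eqI[OF this, of i] show ?thesis by simp
qed

lemma T_expand:
  assumes "degree q \<le> N"
  shows "T q = (\<Sum>i\<le>N. smult (ev i * coord q i) (eigenpoly i))"
proof -
  have "T q = T (\<Sum>i\<le>N. smult (coord q i) (eigenpoly i))" by (simp add: coord_expand assms)
  also have "\<dots> = (\<Sum>i\<le>N. smult (ev i * coord q i) (eigenpoly i))"
    by (simp add: T_sum T_smult eigenpoly(3) mult.commute)
  finally show ?thesis .
qed

end

section \<open>Affine substitution, Lagrange interpolation and auxiliary facts on functions\<close>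

lemma coeff_pcompose_linear:
  fixes q :: "'a :: field poly"
  assumes "b \<noteq> 0" "degree q \<le> n"
  shows "coeff (pcompose q [:a, b:]) n = b ^ n * coeff q n"
proof (cases "degree q = n")
  case True
  then show ?thesis using lead_coeff_comp[of "[:a, b:]" q] assms(1)
    by (simp add: degree_pcompose mult.commute)
next
  case False
  then show ?thesis using assms by (simp add: coeff_eq_0 degree_pcompose)
qed

definition lagrange_basis :: "'a :: field set \<Rightarrow> 'a \<Rightarrow> 'a poly" where
  "lagrange_basis T x = (\<Prod>y\<in>T - {x}. smult (1 / (x - y)) [:- y, 1:])"

text \<open>Both sides have degree below \<open>card T\<close> and agree on
  \<open>T\<close>.\<close>

lemma lagrange_interpolation:
  assumes "finite T" "degree q < card T"
  shows "q = (\<Sum>x\<in>T. smult (poly q x) (lagrange_basis T x))"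
proof (rule poly_eqI_degree[where A = T])
  have deg: "degree (lagrange_basis T x) \<le> card T - 1" if "x \<in> T" for x
  proof -
    have "degree (lagrange_basis T x) \<le> (\<Sum>y\<in>T - {x}. degree (smult (1 / (x - y)) [:- y, 1:]))"
      using degree_prod_sum_le[of "T - {x}" "\<lambda>y. smult (1 / (x - y)) [:- y, 1:]"] assms(1)
      unfolding lagrange_basis_def by (simp only: o_def finite_Diff)
    also have "\<dots> \<le> (\<Sum>y\<in>T - {x}. 1)" by (rule sum_mono) simp
    finally show ?thesis using that assms by simp
  qed
  have "degree (\<Sum>x\<in>T. smult (poly q x) (lagrange_basis T x)) \<le> card T - 1"
    by (rule degree_sum_le[OF assms(1)]) (meson deg degree_smult_le order_trans)
  then show "degree (\<Sum>x\<in>T. smult (poly q x) (lagrange_basis T x)) < card T"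
    using assms(2) by linarith
  fix x assume x: "x \<in> T"
  have "poly (lagrange_basis T y) x = (if y = x then 1 else 0)" if "y \<in> T" for y
  proof (cases "y = x")
    case True
    then show ?thesis unfolding lagrange_basis_def poly_prod
      by (auto intro!: prod.neutral simp: diff_divide_distrib[symmetric] split: if_splits)
  next
    case False
    then have "x \<in> T - {y}" using x by simp
    then show ?thesis unfolding lagrange_basis_def poly_prod
      using False assms(1) by (intro trans[OF prod_zero]) auto
  qed
  then have "poly (\<Sum>y\<in>T. smult (poly q y) (lagrange_basis T y)) x = (\<Sum>y\<in>T. if y = x then poly q y else 0)"
    by (simp add: poly_sum) (intro sum.cong, auto)
  then show "poly q x = poly (\<Sum>y\<in>T. smult (poly q y) (lagrange_basis T y)) x"
    using x assms(1) by simp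
qed (rule assms)

lemma weakly_holomorphic_on_subset:
  "weakly_holomorphic_on \<beta> p R D \<Longrightarrow> D' \<subseteq> D \<Longrightarrow> weakly_holomorphic_on \<beta> p R D'"
  unfolding weakly_holomorphic_on_def by (meson holomorphic_on_subset subsetD)

lemma borel_measurable_cnj [measurable (raw)]:
  "f \<in> borel_measurable M \<Longrightarrow> (\<lambda>x. cnj (f x)) \<in> borel_measurable M"
  by (rule borel_measurable_continuous_on) (auto intro: continuous_intros)

subsection \<open>The shift and its Perron--Frobenius operator\<close>

locale bernoulli_weights =
  fixes \<beta> :: nat and p :: "nat \<Rightarrow> real"
  assumes two_le: "2 \<le> \<beta>"
    and p_pos: "i < \<beta> \<Longrightarrow> 0 < p i"
    and p_sum: "(\<Sum>i<\<beta>. p i) = 1"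
begin

text \<open>Left end of interval number \<open>a\<close> when [0,1] is cut into consecutive
  intervals of lengths \<open>p 0\<close>, \<open>p 1\<close>, and so on.\<close>

definition offset :: "nat \<Rightarrow> real" where
  "offset a = (\<Sum>j<a. p j)"

text \<open>The Perron-Frobenius operator in the variable \<open>x = h\<close>: the transfer
  operator of the piecewise linear map whose inverse branches send \<open>x\<close> to
  \<open>offset i + p i * x\<close>.\<close>

definition transfer :: "complex poly \<Rightarrow> complex poly" where
  "transfer q = (\<Sum>i<\<beta>. smult (of_real (p i)) (pcompose q [:of_real (offset i), of_real (p i):]))"

definition ev_real :: "nat \<Rightarrow> real" where
  "ev_real n = (\<Sum>i<\<beta>. p i ^ (n + 1))"

abbreviation ev :: "nat \<Rightarrow> complex" where
  "ev n \<equiv> complex_of_real (ev_real n)"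

lemma p_offset_le: "a < \<beta> \<Longrightarrow> offset a + p a \<le> 1"
proof -
  assume "a < \<beta>"
  then have "(\<Sum>j<Suc a. p j) \<le> (\<Sum>i<\<beta>. p i)"
    by (intro sum_mono2) (auto intro: less_imp_le[OF p_pos])
  then show ?thesis by (simp add: offset_def p_sum)
qed

lemma offset_nonneg: "a < \<beta> \<Longrightarrow> 0 \<le> offset a"
  unfolding offset_def by (intro sum_nonneg less_imp_le[OF p_pos]) simp

lemma p_less_1:
  assumes "i < \<beta>" shows "p i < 1"
proof -
  \<comment> \<open>A symbol other than \<open>i\<close>, available because there are at least two;
    its positive weight keeps \<open>p i\<close> below 1.\<close>
  define j :: nat where "j = (if i = 0 then 1 else 0)"
  have "(\<Sum>k\<in>{i, j}. p k) \<le> (\<Sum>k<\<beta>. p k)"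
    using two_le assms by (intro sum_mono2) (auto simp: j_def intro: less_imp_le[OF p_pos])
  moreover have "0 < p j" using two_le by (intro p_pos) (auto simp: j_def)
  moreover have "i \<noteq> j" by (auto simp: j_def)
  ultimately show ?thesis by (simp add: p_sum)
qed

lemma ev_real_Suc_less: "ev_real (Suc n) < ev_real n"
  unfolding ev_real_def
proof (rule sum_strict_mono)
  show "{..<\<beta>} \<noteq> {}" using two_le by (auto simp: lessThan_empty_iff)
  fix i assume "i \<in> {..<\<beta>}"
  then show "p i ^ (Suc n + 1) < p i ^ (n + 1)"
    using p_pos[of i] p_less_1[of i] by (intro power_strict_decreasing) auto
qed simp

lemma ev_real_pos: "0 < ev_real n"
  unfolding ev_real_def using two_le
  by (intro sum_pos) (auto intro!: p_pos zero_less_power mult_pos_pos simp: lessThan_empty_iff)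

lemma ev_real_less: "m < n \<Longrightarrow> ev_real n < ev_real m"
  by (rule lift_Suc_mono_less[of "\<lambda>n. - ev_real n", simplified]) (auto simp: ev_real_Suc_less)

lemma ev_real_le_1: "ev_real n \<le> 1"
  using ev_real_less[of 0 n] by (cases "n = 0") (auto simp: ev_real_def p_sum)

lemma inj_ev: "inj ev"
  by (rule injI) (metis ev_real_less less_irrefl nat_neq_iff of_real_eq_iff)

lemma ev_real_tendsto_0: "ev_real \<longlonglongrightarrow> 0"
proof -
  have "(\<lambda>n. \<Sum>i<\<beta>. p i * p i ^ n) \<longlonglongrightarrow> (\<Sum>i<\<beta>. p i * 0)"
    using p_less_1 p_pos
    by (intro tendsto_sum tendsto_mult tendsto_const LIMSEQ_realpow_zero) (auto intro: less_imp_le)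
  then show ?thesis by (simp add: ev_real_def[abs_def])
qed

text \<open>Substituting an affine map of slope \<open>p i\<close> multiplies the coefficient at
  \<open>n\<close> by \<open>p i ^ n\<close>; the weight in front supplies the extra factor in the
  exponent \<open>n + 1\<close>.\<close>

sublocale triangular_operator transfer ev
proof
  show "transfer (q + r) = transfer q + transfer r" for q r
    by (simp add: transfer_def pcompose_add smult_add_right sum.distrib)
  show "transfer (smult a q) = smult a (transfer q)" for a q
    by (simp add: transfer_def pcompose_smult smult_sum_right mult.commute)
  show "coeff (transfer q) n = ev n * coeff q n" if "degree q \<le> n" for q n
  proof -
    have "coeff (transfer q) n = (\<Sum>i<\<beta>. of_real (p i) * (of_real (p i) ^ n * coeff q n))"
      unfolding transfer_def coeff_sum
    proof (intro sum.cong refl)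
      fix i assume "i \<in> {..<\<beta>}"
      then have "complex_of_real (p i) \<noteq> 0" using p_pos[of i] by simp
      from coeff_pcompose_linear[OF this that]
      show "coeff (smult (of_real (p i)) (pcompose q [:of_real (offset i), of_real (p i):])) n =
          of_real (p i) * (of_real (p i) ^ n * coeff q n)" by simp
    qed
    then show ?thesis by (simp add: ev_real_def sum_distrib_right mult.assoc)
  qed
qed (rule inj_ev)

lemma poly_transfer:
  "poly (transfer q) x = (\<Sum>i<\<beta>. of_real (p i) * poly q (of_real (offset i) + of_real (p i) * x))"
  by (simp add: transfer_def poly_sum poly_pcompose mult.commute)

section \<open>The Bernoulli measure and prefixing of a symbol\<close>

abbreviation M0 :: "nat measure" where
  "M0 \<equiv> point_measure {..<\<beta>} (\<lambda>i. ennreal (p i))"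

abbreviation \<mu> :: "sq measure" where
  "\<mu> \<equiv> bernoulli_measure \<beta> p"

abbreviation h :: "sq \<Rightarrow> real" where
  "h \<equiv> h_fun \<beta> p"

lemma prob_space_M0: "prob_space M0"
proof (rule prob_space_point_measure)
  have "(\<Sum>s<\<beta>. ennreal (p s)) = ennreal (\<Sum>s<\<beta>. p s)"
    by (rule sum_ennreal) (simp add: less_imp_le[OF p_pos])
  then show "(\<Sum>s<\<beta>. ennreal (p s)) = 1" by (simp add: p_sum)
qed auto

sublocale seq: sequence_space M0
  using prob_space_M0 by (intro sequence_space.intro product_prob_spaceI)

lemma bernoulli_eq: "\<mu> = (\<Pi>\<^sub>M i\<in>UNIV. M0)"
  by (simp add: bernoulli_measure_def)

sublocale bern: prob_space \<mu>
  unfolding bernoulli_eq by (rule seq.prob_space_axioms)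

lemma pair_prob: "pair_prob_space M0 \<mu>"
  using prob_space_M0 bern.prob_space_axioms
  by (simp add: pair_prob_space_def pair_sigma_finite_def prob_space_imp_sigma_finite)

lemma space_bernoulli: "space \<mu> = {\<omega>. \<forall>n. \<omega> n < \<beta>}"
  by (auto simp: bernoulli_eq space_PiM space_point_measure PiE_def)

lemma measurable_cons_pair [measurable]: "(\<lambda>(s, \<omega>). case_nat s \<omega>) \<in> measurable (M0 \<Otimes>\<^sub>M \<mu>) \<mu>"
  unfolding bernoulli_eq by measurable

lemma measurable_cons [measurable]: "i < \<beta> \<Longrightarrow> case_nat i \<in> measurable \<mu> \<mu>"
  unfolding bernoulli_eq by (rule measurable_case_nat') (auto simp: space_point_measure)

lemma measurable_lshift [measurable]: "lshift \<in> measurable \<mu> \<mu>"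
  unfolding bernoulli_eq lshift_def
  by (intro measurable_PiM_single' measurable_component_singleton)
    (auto simp: space_PiM space_point_measure)

text \<open>Self-similarity of the measure: an independent symbol put in front of a Bernoulli
  sequence gives a Bernoulli sequence. Shift invariance, null sets and integrals are all handled
  through it.\<close>

lemma distr_cons: "distr (M0 \<Otimes>\<^sub>M \<mu>) \<mu> (\<lambda>(s, \<omega>). case_nat s \<omega>) = \<mu>"
  unfolding bernoulli_eq by (rule seq.PiM_iter)

lemma lshift_cons [simp]: "lshift (case_nat i \<omega>) = \<omega>"
  by (simp add: lshift_def)

lemma cons_in_space: "i < \<beta> \<Longrightarrow> \<omega> \<in> space \<mu> \<Longrightarrow> case_nat i \<omega> \<in> space \<mu>"
  by (auto simp: space_bernoulli split: nat.split)

text \<open>Composed with the prefix map the shift is the second projection, and the first factor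
  has mass 1.\<close>

lemma distr_lshift: "distr \<mu> \<mu> lshift = \<mu>"
proof -
  have "distr \<mu> \<mu> lshift = distr (distr (M0 \<Otimes>\<^sub>M \<mu>) \<mu> (\<lambda>(s, \<omega>). case_nat s \<omega>)) \<mu> lshift"
    by (simp add: distr_cons)
  also have "\<dots> = distr (M0 \<Otimes>\<^sub>M \<mu>) \<mu> (lshift \<circ> (\<lambda>(s, \<omega>). case_nat s \<omega>))"
    by (rule distr_distr) measurable
  also have "lshift \<circ> (\<lambda>(s, \<omega>). case_nat s \<omega>) = snd"
    by (auto simp: fun_eq_iff)
  also have "distr (M0 \<Otimes>\<^sub>M \<mu>) \<mu> snd = \<mu>"
  proof -
    show ?thesis
    proof (rule measure_eqI)
      fix A assume A: "A \<in> sets (distr (M0 \<Otimes>\<^sub>M \<mu>) \<mu> snd)"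
      then have "emeasure (distr (M0 \<Otimes>\<^sub>M \<mu>) \<mu> snd) A = emeasure (M0 \<Otimes>\<^sub>M \<mu>) (space M0 \<times> A)"
        by (auto simp: emeasure_distr space_pair_measure dest: sets.sets_into_space
            intro!: arg_cong2[where f=emeasure])
      with A show "emeasure (distr (M0 \<Otimes>\<^sub>M \<mu>) \<mu> snd) A = emeasure \<mu> A"
        by (simp add: bern.emeasure_pair_measure_Times prob_space.emeasure_space_1[OF prob_space_M0])
    qed simp
  qed
  finally show ?thesis .
qed

text \<open>By self-similarity the property holds after prefixing almost every symbol, and every
  symbol has positive weight.\<close>

lemma AE_cons:
  assumes "AE \<omega> in \<mu>. P \<omega>" and i: "i < \<beta>"
  shows "AE \<omega> in \<mu>. P (case_nat i \<omega>)"
proof -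
  interpret pair_prob_space M0 \<mu> by (rule pair_prob)
  have "AE x in M0 \<Otimes>\<^sub>M \<mu>. P ((\<lambda>(s, \<omega>). case_nat s \<omega>) x)"
    by (rule AE_distrD[OF measurable_cons_pair]) (unfold distr_cons, rule assms(1))
  then have "AE s in M0. AE \<omega> in \<mu>. P (case_nat s \<omega>)"
    by (drule_tac AE_pair) simp
  then show ?thesis using i p_pos by (simp add: AE_point_measure)
qed

text \<open>Fubini along the prefix map, that is, conditioning on the first coordinate.\<close>

lemma integral_cons:
  fixes f :: "sq \<Rightarrow> 'b :: {banach, second_countable_topology}"
  assumes f: "integrable \<mu> f"
  shows "(\<integral>\<omega>. f \<omega> \<partial>\<mu>) = (\<Sum>i<\<beta>. p i *\<^sub>R (\<integral>\<omega>. f (case_nat i \<omega>) \<partial>\<mu>))"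
    and "i < \<beta> \<Longrightarrow> integrable \<mu> (\<lambda>\<omega>. f (case_nat i \<omega>))"
proof -
  interpret pair_prob_space M0 \<mu> by (rule pair_prob)
  let ?F = "\<lambda>x. f ((\<lambda>(s, \<omega>). case_nat s \<omega>) x)"
  note fm [measurable] = borel_measurable_integrable[OF f]
  have int: "integrable (M0 \<Otimes>\<^sub>M \<mu>) ?F"
    using f by (subst integrable_distr_eq[OF measurable_cons_pair, symmetric]) (simp_all add: distr_cons)
  show "i < \<beta> \<Longrightarrow> integrable \<mu> (\<lambda>\<omega>. f (case_nat i \<omega>))"
    using AE_integrable_fst'[OF int] p_pos by (simp add: AE_point_measure)
  have "(\<integral>\<omega>. f \<omega> \<partial>\<mu>) = integral\<^sup>L (distr (M0 \<Otimes>\<^sub>M \<mu>) \<mu> (\<lambda>(s, \<omega>). case_nat s \<omega>)) f"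
    by (simp add: distr_cons)
  also have "\<dots> = integral\<^sup>L (M0 \<Otimes>\<^sub>M \<mu>) ?F"
    by (rule integral_distr) measurable
  also have "\<dots> = (\<integral>s. (\<integral>\<omega>. f (case_nat s \<omega>) \<partial>\<mu>) \<partial>M0)"
    using integral_fst'[OF int] by simp
  also have "\<dots> = (\<Sum>i<\<beta>. p i *\<^sub>R (\<integral>\<omega>. f (case_nat i \<omega>) \<partial>\<mu>))"
    by (rule lebesgue_integral_point_measure_finite) (auto intro: less_imp_le[OF p_pos])
  finally show "(\<integral>\<omega>. f \<omega> \<partial>\<mu>) = (\<Sum>i<\<beta>. p i *\<^sub>R (\<integral>\<omega>. f (case_nat i \<omega>) \<partial>\<mu>))" .
qed

section \<open>Square-integrable functions and the adjoint of the Koopman operator\<close>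

abbreviation L2s :: "obs set" where "L2s \<equiv> L2 \<beta> p"
abbreviation inner2 :: "obs \<Rightarrow> obs \<Rightarrow> complex" where "inner2 \<equiv> L2_inner \<beta> p"

lemma L2D:
  assumes "f \<in> L2s"
  shows "f \<in> borel_measurable \<mu>" "integrable \<mu> (\<lambda>\<omega>. (cmod (f \<omega>))\<^sup>2)"
  using assms by (auto simp: L2_def)

lemma integrable_L2_mult:
  assumes "f \<in> L2s" "g \<in> L2s"
  shows "integrable \<mu> (\<lambda>\<omega>. f \<omega> * cnj (g \<omega>))"
proof (rule Bochner_Integration.integrable_bound)
  note [measurable] = L2D(1)[OF assms(1)] L2D(1)[OF assms(2)]
  show "integrable \<mu> (\<lambda>\<omega>. (cmod (f \<omega>))\<^sup>2 + (cmod (g \<omega>))\<^sup>2)"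
    using assms L2D by auto
  show "(\<lambda>\<omega>. f \<omega> * cnj (g \<omega>)) \<in> borel_measurable \<mu>" by measurable
  have "cmod a * cmod b \<le> (cmod a)\<^sup>2 + (cmod b)\<^sup>2" for a b :: complex
    using sum_squares_bound[of "cmod a" "cmod b"] norm_ge_zero[of "a * b"]
    unfolding mult.assoc norm_mult by linarith
  then show "AE \<omega> in \<mu>. norm (f \<omega> * cnj (g \<omega>)) \<le> norm ((cmod (f \<omega>))\<^sup>2 + (cmod (g \<omega>))\<^sup>2)"
    by (intro AE_I2) (simp add: norm_mult)
qed

lemma L2_add:
  assumes "f \<in> L2s" "g \<in> L2s"
  shows "(\<lambda>\<omega>. f \<omega> + g \<omega>) \<in> L2s"
proof -
  note [measurable] = L2D(1)[OF assms(1)] L2D(1)[OF assms(2)]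
  have bound: "(cmod (a + b))\<^sup>2 \<le> 2 * (cmod a)\<^sup>2 + 2 * (cmod b)\<^sup>2" for a b :: complex
  proof -
    have "(cmod (a + b))\<^sup>2 \<le> (cmod a + cmod b)\<^sup>2"
      by (intro power_mono norm_triangle_ineq) auto
    also have "\<dots> \<le> 2 * (cmod a)\<^sup>2 + 2 * (cmod b)\<^sup>2"
      using sum_squares_bound[of "cmod a" "cmod b"] by (simp add: power2_sum)
    finally show ?thesis .
  qed
  have "integrable \<mu> (\<lambda>\<omega>. (cmod (f \<omega> + g \<omega>))\<^sup>2)"
  proof (rule Bochner_Integration.integrable_bound)
    show "integrable \<mu> (\<lambda>\<omega>. 2 * (cmod (f \<omega>))\<^sup>2 + 2 * (cmod (g \<omega>))\<^sup>2)"
      by (intro Bochner_Integration.integrable_add integrable_mult_right L2D assms)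
    show "AE \<omega> in \<mu>. norm ((cmod (f \<omega> + g \<omega>))\<^sup>2) \<le> norm (2 * (cmod (f \<omega>))\<^sup>2 + 2 * (cmod (g \<omega>))\<^sup>2)"
      using bound by (intro AE_I2) (simp only: real_norm_def abs_of_nonneg zero_le_power2 add_nonneg_nonneg mult_nonneg_nonneg zero_le_numeral)
  qed measurable
  then show ?thesis by (simp add: L2_def)
qed

lemma L2_scale:
  assumes "f \<in> L2s"
  shows "(\<lambda>\<omega>. c * f \<omega>) \<in> L2s"
proof -
  note [measurable] = L2D(1)[OF assms]
  show ?thesis using L2D(2)[OF assms] by (simp add: L2_def norm_mult power_mult_distrib)
qed

lemma L2_sum: "finite A \<Longrightarrow> (\<And>i. i \<in> A \<Longrightarrow> f i \<in> L2s) \<Longrightarrow> (\<lambda>\<omega>. \<Sum>i\<in>A. f i \<omega>) \<in> L2s"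
proof (induction A rule: finite_induct)
  case empty
  then show ?case by (simp add: L2_def)
next
  case (insert x F)
  then show ?case using L2_add[of "f x" "\<lambda>\<omega>. \<Sum>i\<in>F. f i \<omega>"] by simp
qed

lemma L2_diff: "f \<in> L2s \<Longrightarrow> g \<in> L2s \<Longrightarrow> (\<lambda>\<omega>. f \<omega> - g \<omega>) \<in> L2s"
  using L2_add[of f "\<lambda>\<omega>. - 1 * g \<omega>"] L2_scale[of g "- 1"] by simp

lemma L2_cons:
  assumes "f \<in> L2s" "i < \<beta>"
  shows "(\<lambda>\<omega>. f (case_nat i \<omega>)) \<in> L2s"
proof -
  note [measurable] = L2D(1)[OF assms(1)]
  have "(\<lambda>\<omega>. f (case_nat i \<omega>)) \<in> borel_measurable \<mu>"
    using assms(2) by measurable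
  then show ?thesis using integral_cons(2)[OF L2D(2)[OF assms(1)] assms(2)] by (simp add: L2_def)
qed

lemma L2_koopman:
  assumes "k \<in> L2s"
  shows "koopman k \<in> L2s" and "(\<integral>\<omega>. (cmod (koopman k \<omega>))\<^sup>2 \<partial>\<mu>) = (\<integral>\<omega>. (cmod (k \<omega>))\<^sup>2 \<partial>\<mu>)"
proof -
  note [measurable] = L2D(1)[OF assms]
  have "integrable \<mu> (\<lambda>\<omega>. (cmod (k (lshift \<omega>)))\<^sup>2)"
    using L2D(2)[OF assms] integrable_distr_eq[OF measurable_lshift, of "\<lambda>\<omega>. (cmod (k \<omega>))\<^sup>2"]
    by (simp add: distr_lshift)
  then show "koopman k \<in> L2s" by (simp add: L2_def koopman_def)
  show "(\<integral>\<omega>. (cmod (koopman k \<omega>))\<^sup>2 \<partial>\<mu>) = (\<integral>\<omega>. (cmod (k \<omega>))\<^sup>2 \<partial>\<mu>)"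
    using integral_distr[OF measurable_lshift, of "\<lambda>\<omega>. (cmod (k \<omega>))\<^sup>2"]
    by (simp add: distr_lshift koopman_def)
qed

lemma inner2_self: "inner2 f f = of_real (\<integral>\<omega>. (cmod (f \<omega>))\<^sup>2 \<partial>\<mu>)"
  unfolding L2_inner_def complex_norm_square[symmetric] by (rule integral_complex_of_real)

lemma inner2_self_0:
  assumes "f \<in> L2s" "inner2 f f = 0"
  shows "AE \<omega> in \<mu>. f \<omega> = 0"
proof -
  have "(\<integral>\<omega>. (cmod (f \<omega>))\<^sup>2 \<partial>\<mu>) = 0" using assms(2) by (simp add: inner2_self)
  then have "AE \<omega> in \<mu>. (cmod (f \<omega>))\<^sup>2 = 0"
    using L2D(2)[OF assms(1)] by (subst (asm) integral_nonneg_eq_0_iff_AE) auto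
  then show ?thesis by simp
qed

lemma inner2_diff_left:
  assumes "f \<in> L2s" "g \<in> L2s" "k \<in> L2s"
  shows "inner2 (\<lambda>\<omega>. f \<omega> - g \<omega>) k = inner2 f k - inner2 g k"
  unfolding L2_inner_def left_diff_distrib
  by (intro Bochner_Integration.integral_diff integrable_L2_mult assms)

lemma inner2_cong_AE:
  assumes "AE \<omega> in \<mu>. f \<omega> = g \<omega>" "f \<in> L2s" "g \<in> L2s" "k \<in> L2s"
  shows "inner2 f k = inner2 g k"
proof -
  note [measurable] = L2D(1)[OF assms(2)] L2D(1)[OF assms(3)] L2D(1)[OF assms(4)]
  show ?thesis unfolding L2_inner_def
    by (rule integral_cong_AE) (use assms(1) in \<open>auto\<close>)
qed

text \<open>Testing against \<open>f - g\<close> itself. This determines almost everywhere the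
  representative that \<open>perron_frobenius\<close> chooses.\<close>

lemma L2_eqI_inner:
  assumes "f \<in> L2s" "g \<in> L2s" "\<And>k. k \<in> L2s \<Longrightarrow> inner2 f k = inner2 g k"
  shows "AE \<omega> in \<mu>. f \<omega> = g \<omega>"
proof -
  let ?d = "\<lambda>\<omega>. f \<omega> - g \<omega>"
  have d: "?d \<in> L2s" using assms L2_diff by blast
  then have "inner2 ?d ?d = 0" using assms inner2_diff_left[OF assms(1,2) d] by simp
  from inner2_self_0[OF d this] show ?thesis by simp
qed

text \<open>Since \<open>koopman k\<close> ignores the first coordinate, conditioning on that
  coordinate averages \<open>f\<close> alone.\<close>

lemma adjoint_formula:
  fixes f :: obs
  assumes f: "f \<in> L2s"
  shows "(\<lambda>\<omega>. \<Sum>i<\<beta>. of_real (p i) * f (case_nat i \<omega>)) \<in> L2s" (is "?g \<in> _")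
    and "k \<in> L2s \<Longrightarrow> inner2 (\<lambda>\<omega>. \<Sum>i<\<beta>. of_real (p i) * f (case_nat i \<omega>)) k = inner2 f (koopman k)"
proof -
  show "?g \<in> L2s" by (intro L2_sum L2_scale L2_cons f) auto
  assume k: "k \<in> L2s"
  have int: "integrable \<mu> (\<lambda>\<omega>. f \<omega> * cnj (k (lshift \<omega>)))"
    using integrable_L2_mult[OF f L2_koopman(1)[OF k]] by (simp add: koopman_def)
  have "inner2 f (koopman k) = (\<Sum>i<\<beta>. p i *\<^sub>R (\<integral>\<omega>. f (case_nat i \<omega>) * cnj (k \<omega>) \<partial>\<mu>))"
    using integral_cons(1)[OF int] by (simp add: L2_inner_def koopman_def)
  also have "\<dots> = (\<integral>\<omega>. (\<Sum>i<\<beta>. p i *\<^sub>R (f (case_nat i \<omega>) * cnj (k \<omega>))) \<partial>\<mu>)"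
    using integral_cons(2)[OF int]
    by (subst Bochner_Integration.integral_sum) (auto simp del: scaleR_conv_of_real)
  also have "\<dots> = inner2 ?g k"
    by (simp add: L2_inner_def sum_distrib_right scaleR_conv_of_real mult.assoc)
  finally show "inner2 ?g k = inner2 f (koopman k)" by simp
qed

abbreviation PF :: "obs \<Rightarrow> obs" where "PF \<equiv> perron_frobenius \<beta> p"

lemma PF:
  fixes f :: obs
  assumes "f \<in> L2s"
  shows "PF f \<in> L2s" "k \<in> L2s \<Longrightarrow> inner2 (PF f) k = inner2 f (koopman k)"
    "AE \<omega> in \<mu>. PF f \<omega> = (\<Sum>i<\<beta>. of_real (p i) * f (case_nat i \<omega>))"
proof -
  have "\<exists>g. g \<in> L2s \<and> (\<forall>k\<in>L2s. inner2 g k = inner2 f (koopman k))"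
    using adjoint_formula[OF assms] by blast
  from someI_ex[OF this]
  have *: "PF f \<in> L2s" "\<forall>k\<in>L2s. inner2 (PF f) k = inner2 f (koopman k)"
    unfolding perron_frobenius_def by auto
  then show "PF f \<in> L2s" "k \<in> L2s \<Longrightarrow> inner2 (PF f) k = inner2 f (koopman k)" by auto
  show "AE \<omega> in \<mu>. PF f \<omega> = (\<Sum>i<\<beta>. of_real (p i) * f (case_nat i \<omega>))"
    by (rule L2_eqI_inner) (use * adjoint_formula[OF assms] in auto)
qed

text \<open>The Koopman operator is an isometry, so pairing the equation with \<open>g\<close>
  bounds \<open>cmod z\<close> times the squared norm of \<open>g\<close> by that squared norm. This
  makes the resolvent unique almost everywhere outside the closed unit disc.\<close>

lemma resolvent_kernel:
  assumes z: "cmod z > 1" and g: "g \<in> L2s" and eq: "AE \<omega> in \<mu>. z * g \<omega> = PF g \<omega>"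
  shows "AE \<omega> in \<mu>. g \<omega> = 0"
proof -
  define n where "n = (\<integral>\<omega>. (cmod (g \<omega>))\<^sup>2 \<partial>\<mu>)"
  have n0: "n \<ge> 0" by (simp add: n_def)
  have "z * of_real n = z * inner2 g g"
    by (simp add: n_def inner2_self)
  also have "\<dots> = inner2 (\<lambda>\<omega>. z * g \<omega>) g"
    by (simp add: L2_inner_def mult.assoc)
  also have "\<dots> = inner2 (PF g) g"
    by (rule inner2_cong_AE[OF eq L2_scale[OF g] PF(1)[OF g] g])
  also have "\<dots> = inner2 g (koopman g)" by (rule PF(2)[OF g g])
  finally have "cmod z * n = cmod (inner2 g (koopman g))"
    using n0 by (metis abs_of_nonneg norm_mult norm_of_real)
  also have "\<dots> \<le> (\<integral>\<omega>. cmod (g \<omega> * cnj (koopman g \<omega>)) \<partial>\<mu>)"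
    unfolding L2_inner_def by (rule integral_norm_bound)
  also have "\<dots> \<le> (\<integral>\<omega>. ((cmod (g \<omega>))\<^sup>2 + (cmod (koopman g \<omega>))\<^sup>2) / 2 \<partial>\<mu>)"
  proof (rule integral_mono)
    show "integrable \<mu> (\<lambda>\<omega>. cmod (g \<omega> * cnj (koopman g \<omega>)))"
      by (intro integrable_norm integrable_L2_mult g L2_koopman)
    show "integrable \<mu> (\<lambda>\<omega>. ((cmod (g \<omega>))\<^sup>2 + (cmod (koopman g \<omega>))\<^sup>2) / 2)"
      using L2D(2)[OF g] L2D(2)[OF L2_koopman(1)[OF g]] by simp
    show "cmod (g \<omega> * cnj (koopman g \<omega>)) \<le> ((cmod (g \<omega>))\<^sup>2 + (cmod (koopman g \<omega>))\<^sup>2) / 2" for \<omega>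
      using sum_squares_bound[of "cmod (g \<omega>)" "cmod (koopman g \<omega>)"] by (simp add: norm_mult)
  qed
  also have "\<dots> = n"
    using L2D(2)[OF g] L2D(2)[OF L2_koopman(1)[OF g]] L2_koopman(2)[OF g] by (simp add: n_def)
  finally have "(cmod z - 1) * n \<le> 0" by (simp add: algebra_simps)
  then have "n = 0" using z n0 by (simp add: mult_le_0_iff)
  then show ?thesis by (intro inner2_self_0[OF g]) (simp add: inner2_self n_def)
qed

subsection \<open>Polynomials in h\<close>

lemma prod_visits:
  assumes "\<omega> \<in> space \<mu>"
  shows "(\<Prod>k<\<beta>. p k ^ card {i. i < n \<and> \<omega> i = k}) = (\<Prod>i<n. p (\<omega> i))"
proof -
  have "(\<Prod>k<\<beta>. p k ^ card {i. i < n \<and> \<omega> i = k}) = (\<Prod>k<\<beta>. \<Prod>i\<in>{i \<in> {..<n}. \<omega> i = k}. p (\<omega> i))"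
    by (intro prod.cong refl) simp
  also have "\<dots> = (\<Prod>i<n. p (\<omega> i))"
    by (rule prod.group) (use assms in \<open>auto simp: space_bernoulli\<close>)
  finally show ?thesis .
qed

text \<open>Since \<open>offset 0\<close> is an empty sum, the case distinction on
  \<open>\<omega> n\<close> in \<open>h_fun\<close> is built in.\<close>

definition h_term :: "sq \<Rightarrow> nat \<Rightarrow> real" where
  "h_term \<omega> n = offset (\<omega> n) * (\<Prod>i<n. p (\<omega> i))"

lemma h_eq_suminf: "\<omega> \<in> space \<mu> \<Longrightarrow> h \<omega> = (\<Sum>n. h_term \<omega> n)"
  unfolding h_fun_def
  by (intro suminf_cong) (auto simp: prod_visits h_term_def offset_def)

lemma h_term_nonneg: "\<omega> \<in> space \<mu> \<Longrightarrow> 0 \<le> h_term \<omega> n"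
  unfolding h_term_def space_bernoulli
  by (intro mult_nonneg_nonneg prod_nonneg offset_nonneg) (auto intro: less_imp_le[OF p_pos])

text \<open>The first \<open>N\<close> symbols select an interval that starts at the partial sum and
  has the product as its length. That its right end is at most 1 is strong enough for the induction,
  unlike the bare bound on the sum.\<close>

lemma h_partial_sum_le:
  assumes "\<omega> \<in> space \<mu>"
  shows "(\<Sum>n<N. h_term \<omega> n) \<le> 1 - (\<Prod>i<N. p (\<omega> i))"
proof (induction N)
  case (Suc N)
  have \<omega>: "\<omega> i < \<beta>" for i using assms by (simp add: space_bernoulli)
  have "(offset (\<omega> N) + p (\<omega> N)) * (\<Prod>i<N. p (\<omega> i)) \<le> 1 * (\<Prod>i<N. p (\<omega> i))"
    by (intro mult_right_mono p_offset_le prod_nonneg \<omega>) (simp add: less_imp_le[OF p_pos] \<omega>)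
  with Suc show ?case by (simp add: h_term_def algebra_simps)
qed simp

lemma h_partial_sum_le_1: "\<omega> \<in> space \<mu> \<Longrightarrow> (\<Sum>n<N. h_term \<omega> n) \<le> 1"
  using h_partial_sum_le[of \<omega> N] prod_nonneg[of "{..<N}" "\<lambda>i. p (\<omega> i)"]
  by (auto simp: space_bernoulli less_imp_le[OF p_pos])

lemma summable_h_term: "\<omega> \<in> space \<mu> \<Longrightarrow> summable (h_term \<omega>)"
  by (rule bounded_imp_summable[of _ 1])
    (use h_term_nonneg h_partial_sum_le_1[of \<omega> "Suc _"] in \<open>auto simp: lessThan_Suc_atMost\<close>)

lemma h_bounds:
  assumes "\<omega> \<in> space \<mu>"
  shows "0 \<le> h \<omega>" "h \<omega> \<le> 1"
proof -
  show "0 \<le> h \<omega>" using assms summable_h_term h_term_nonneg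
    by (simp add: h_eq_suminf suminf_nonneg)
  show "h \<omega> \<le> 1" using assms summable_h_term h_partial_sum_le_1
    by (simp add: h_eq_suminf suminf_le_const)
qed

text \<open>After its first term, the series of the prefixed sequence is \<open>p i\<close> times
  the original one. So \<open>h\<close> turns prefixing into an affine inverse branch.\<close>

lemma h_cons:
  assumes "\<omega> \<in> space \<mu>" "i < \<beta>"
  shows "h (case_nat i \<omega>) = offset i + p i * h \<omega>"
proof -
  let ?\<omega> = "case_nat i \<omega>"
  have in_space: "?\<omega> \<in> space \<mu>" using assms by (simp add: cons_in_space)
  have "h_term ?\<omega> (Suc n) = p i * h_term \<omega> n" for n
    by (simp add: h_term_def prod.lessThan_Suc_shift del: prod.lessThan_Suc)
  then have "(\<Sum>n. h_term ?\<omega> (Suc n)) = p i * h \<omega>"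
    using suminf_mult[OF summable_h_term[OF assms(1)], of "p i"] assms by (simp add: h_eq_suminf)
  moreover have "h_term ?\<omega> 0 = offset i" by (simp add: h_term_def)
  ultimately show ?thesis
    using suminf_split_head[OF summable_h_term[OF in_space]] h_eq_suminf[OF in_space] by simp
qed

lemma measurable_coordinate: "(\<lambda>\<omega>. (F (\<omega> n) :: real)) \<in> borel_measurable \<mu>"
  unfolding bernoulli_eq
  by (rule measurable_compose[OF measurable_component_singleton]) auto

lemma measurable_h [measurable]: "h \<in> borel_measurable \<mu>"
proof (subst measurable_cong[OF h_eq_suminf])
  show "(\<lambda>\<omega>. \<Sum>n. h_term \<omega> n) \<in> borel_measurable \<mu>"
    unfolding h_term_def
    by (intro borel_measurable_suminf borel_measurable_times borel_measurable_prod
        measurable_coordinate)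
qed simp

section \<open>Observables: polynomials evaluated at h\<close>

definition observable :: "complex poly \<Rightarrow> obs" where
  "observable q = (\<lambda>\<omega>. poly q (of_real (h \<omega>)))"

lemma observable_L2: "observable q \<in> L2s"
proof -
  have "bounded (poly q ` cball 0 1)"
    by (intro compact_imp_bounded compact_continuous_image continuous_intros) auto
  then obtain B where B: "\<And>x. x \<in> cball 0 1 \<Longrightarrow> cmod (poly q x) \<le> B"
    unfolding bounded_iff by blast
  have [measurable]: "observable q \<in> borel_measurable \<mu>"
    unfolding observable_def
    by (rule measurable_compose[of "\<lambda>\<omega>. complex_of_real (h \<omega>)" _ borel])
      (auto intro!: borel_measurable_continuous_onI continuous_intros)
  have "integrable \<mu> (\<lambda>\<omega>. (cmod (observable q \<omega>))\<^sup>2)"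
  proof (rule bern.integrable_const_bound)
    show "AE \<omega> in \<mu>. norm ((cmod (observable q \<omega>))\<^sup>2) \<le> B\<^sup>2"
      using h_bounds by (intro AE_I2) (auto simp: observable_def intro!: power_mono B)
  qed measurable
  then show ?thesis by (simp add: L2_def)
qed

lemma PF_observable: "AE \<omega> in \<mu>. PF (observable q) \<omega> = observable (transfer q) \<omega>"
  using PF(3)[OF observable_L2[of q]] AE_space
  by eventually_elim (simp add: observable_def poly_transfer h_cons)

lemma AE_cons_zeros:
  assumes "AE \<omega> in \<mu>. P \<omega>"
  shows "AE \<omega> in \<mu>. P ((case_nat 0 ^^ n) \<omega>)"
  using assms
proof (induction n arbitrary: P)
  case (Suc n)
  have "0 < \<beta>" using two_le by simp
  from Suc.IH[OF AE_cons[OF Suc.prems this]] show ?case by simp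
qed simp

text \<open>Along the points \<open>0\<dots>01\<omega>\<close> the function \<open>h\<close> takes infinitely many values, namely
  \<open>p\<^sub>0\<^sup>n (p\<^sub>0 + p\<^sub>1 h(\<omega>))\<close>.\<close>

lemma observable_AE_0:
  assumes "AE \<omega> in \<mu>. observable q \<omega> = 0"
  shows "q = 0"
proof (rule ccontr)
  assume "q \<noteq> 0"
  have b: "0 < \<beta>" "1 < \<beta>" using two_le by auto
  have "AE \<omega> in \<mu>. \<forall>n. observable q ((case_nat 0 ^^ n) (case_nat 1 \<omega>)) = 0"
    unfolding AE_all_countable
    by (intro allI AE_cons[where P = "\<lambda>\<omega>. observable q ((case_nat 0 ^^ _) \<omega>) = 0"]
        AE_cons_zeros assms b)
  then have "AE \<omega> in \<mu>. \<omega> \<in> space \<mu> \<and> (\<forall>n. observable q ((case_nat 0 ^^ n) (case_nat 1 \<omega>)) = 0)"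
    using AE_space by eventually_elim simp
  then have "\<exists>\<omega>. \<omega> \<in> space \<mu> \<and> (\<forall>n. observable q ((case_nat 0 ^^ n) (case_nat 1 \<omega>)) = 0)"
    using eventually_happens'[OF bern.ae_filter_bot] by blast
  then obtain \<omega> where \<omega>: "\<omega> \<in> space \<mu>" "\<And>n. observable q ((case_nat 0 ^^ n) (case_nat 1 \<omega>)) = 0"
    by blast
  define x where "x = h (case_nat 1 \<omega>)"
  have sp: "(case_nat 0 ^^ n) (case_nat 1 \<omega>) \<in> space \<mu>" for n
    by (induction n) (simp_all only: funpow.simps comp_apply id_apply cons_in_space \<omega>(1) b)
  have hn: "h ((case_nat 0 ^^ n) (case_nat 1 \<omega>)) = p 0 ^ n * x" for n
    by (induction n) (simp_all add: h_cons[OF sp b(1)] offset_def x_def del: One_nat_def)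
  \<comment> \<open>The symbol 1 behind the zeros keeps \<open>x\<close> away from 0, where all the
    values \<open>p 0 ^ n * x\<close> would coincide.\<close>
  have "x = p 0 + p 1 * h \<omega>" unfolding x_def h_cons[OF \<omega>(1) b(2)] by (simp add: offset_def)
  then have "x > 0" using p_pos[OF b(1)] p_pos[OF b(2)] h_bounds[OF \<omega>(1)]
    by (simp add: add_pos_nonneg)
  have "inj (\<lambda>n. complex_of_real (p 0 ^ n * x))"
  proof (rule injI)
    fix m n assume "complex_of_real (p 0 ^ m * x) = complex_of_real (p 0 ^ n * x)"
    then have "p 0 ^ m * x = p 0 ^ n * x" by (simp only: of_real_eq_iff)
    then have "p 0 ^ m = p 0 ^ n" using \<open>x > 0\<close> by simp
    then show "m = n"
      using p_pos[OF b(1)] p_less_1[OF b(1)] by (metis linorder_neqE_nat less_irrefl power_strict_decreasing)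
  qed
  moreover have "(\<lambda>n. complex_of_real (p 0 ^ n * x)) ` UNIV \<subseteq> {x. poly q x = 0}"
    using \<omega>(2)[unfolded observable_def hn] by auto
  ultimately have "\<not> finite {x. poly q x = 0}"
    by (meson finite_subset finite_imageD infinite_UNIV_nat)
  then show False using poly_roots_finite[OF \<open>q \<noteq> 0\<close>] by simp
qed

lemma observable_diff: "observable (q - r) \<omega> = observable q \<omega> - observable r \<omega>"
  by (simp add: observable_def)

text \<open>Each class modulo null sets contains at most one polynomial in \<open>h\<close>; this is
  what makes \<open>V_X\<close> well defined.\<close>

lemma observable_AE_inj:
  assumes "AE \<omega> in \<mu>. observable q \<omega> = observable r \<omega>"
  shows "q = r"
  using observable_AE_0[of "q - r"] assms by (simp add: observable_diff)

lemma inj_observable: "inj observable"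
  by (rule injI) (rule observable_AE_inj, simp)

lemma h_poly_conv: "h_poly \<beta> p c n = observable (\<Sum>i\<le>n. monom (c i) i)"
  by (simp add: h_poly_def observable_def fun_eq_iff poly_sum poly_monom)

lemma observable_conv_h_poly: "degree q \<le> n \<Longrightarrow> observable q = h_poly \<beta> p (coeff q) n"
  by (simp add: h_poly_conv poly_as_sum_of_monoms')

lemma degree_sum_monom: "degree (\<Sum>i\<le>n. monom (c i) i) \<le> n"
  by (rule degree_sum_le) (auto intro: order_trans[OF degree_monom_le])

lemma X_n_eq: "X_n \<beta> p n = observable ` {q. degree q \<le> n}"
proof
  show "X_n \<beta> p n \<subseteq> observable ` {q. degree q \<le> n}"
    by (auto simp: X_n_def h_poly_conv degree_sum_monom)
  show "observable ` {q. degree q \<le> n} \<subseteq> X_n \<beta> p n"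
    using observable_conv_h_poly by (auto simp: X_n_def)
qed

abbreviation Xs :: "obs set" where "Xs \<equiv> X \<beta> p"

lemma X_eq: "Xs = range observable"
  by (auto simp: X_def X_n_eq)

lemma observable_in_X [simp]: "observable q \<in> Xs"
  by (simp add: X_eq)

lemma V_X_observable: "V_X \<beta> p (observable q) = observable (transfer q)"
  unfolding V_X_def
proof (rule the_equality)
  show "observable (transfer q) \<in> Xs \<and>
      (AE \<omega> in \<mu>. observable (transfer q) \<omega> = PF (observable q) \<omega>)"
    using PF_observable[of q] by (auto elim: eventually_mono)
next
  fix g assume g: "g \<in> Xs \<and> (AE \<omega> in \<mu>. g \<omega> = PF (observable q) \<omega>)"
  then obtain r where r: "g = observable r" by (auto simp: X_eq)
  have "AE \<omega> in \<mu>. observable r \<omega> = observable (transfer q) \<omega>"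
    using conjunct2[OF g] PF_observable[of q] by eventually_elim (simp add: r)
  from observable_AE_inj[OF this] show "g = observable (transfer q)" by (simp add: r)
qed

lemma Phi_eq: "Phi \<beta> p n = observable (eigenpoly n)"
  unfolding Phi_def
proof (rule the_equality)
  have "(\<lambda>\<omega>. complex_of_real (\<Sum>i<\<beta>. p i ^ (n + 1)) * observable q \<omega>) = observable (smult (ev n) q)" for q
    by (simp add: observable_def ev_real_def)
  note eig = this
  show "(\<exists>c. c n = 1 \<and> observable (eigenpoly n) = h_poly \<beta> p c n) \<and>
      V_X \<beta> p (observable (eigenpoly n)) =
        (\<lambda>\<omega>. complex_of_real (\<Sum>i<\<beta>. p i ^ (n + 1)) * observable (eigenpoly n) \<omega>)"
    unfolding eig V_X_observable eigenpoly(3)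
    using observable_conv_h_poly[OF eigenpoly(1)] eigenpoly(2) by blast
  fix f assume f: "(\<exists>c. c n = 1 \<and> f = h_poly \<beta> p c n) \<and>
      V_X \<beta> p f = (\<lambda>\<omega>. complex_of_real (\<Sum>i<\<beta>. p i ^ (n + 1)) * f \<omega>)"
  then obtain c where c: "c n = 1" "f = h_poly \<beta> p c n" by blast
  define q where "q = (\<Sum>i\<le>n. monom (c i) i)"
  have fq: "f = observable q" by (simp add: c h_poly_conv q_def)
  have "observable (transfer q) = observable (smult (ev n) q)"
    using f by (simp only: fq V_X_observable eig)
  then have "transfer q = smult (ev n) q" using inj_observable by (simp add: inj_eq)
  moreover have "coeff q n = 1" by (simp add: q_def coeff_sum c)
  moreover have "degree q \<le> n" by (simp add: q_def degree_sum_monom)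
  ultimately show "f = observable (eigenpoly n)" using eigenpoly_eqI fq by blast
qed

section \<open>The resolvent on polynomial observables\<close>

definition resolvent_poly :: "complex \<Rightarrow> complex poly \<Rightarrow> complex poly" where
  "resolvent_poly z q = (\<Sum>i\<le>degree q. smult (coord q i / (z - ev i)) (eigenpoly i))"

lemma resolvent_poly:
  assumes "\<And>i. z \<noteq> ev i"
  shows "smult z (resolvent_poly z q) - transfer (resolvent_poly z q) = q"
proof -
  have *: "z * a / (z - ev i) - ev i * a / (z - ev i) = a" for a i
    using assms[of i]
    by (simp add: diff_divide_distrib[symmetric] left_diff_distrib[symmetric])
  have "smult z (resolvent_poly z q) - transfer (resolvent_poly z q) =
      (\<Sum>i\<le>degree q. smult (z * coord q i / (z - ev i) - ev i * coord q i / (z - ev i)) (eigenpoly i))"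
    by (simp add: resolvent_poly_def T_sum T_smult eigenpoly(3) smult_sum_right smult_diff_left
        sum_subtractf mult.commute)
  also have "\<dots> = q" unfolding * by (simp add: coord_expand)
  finally show ?thesis .
qed

text \<open>The polynomial solves the resolvent equation, and any other solution differs from it by
  an element of the trivial kernel of \<open>z - PF\<close>.\<close>

lemma L2_resolvent_observable:
  assumes "cmod z > 1"
  shows "L2_resolvent \<beta> p z (observable q) \<in> L2s"
    and "AE \<omega> in \<mu>. L2_resolvent \<beta> p z (observable q) \<omega> = observable (resolvent_poly z q) \<omega>"
proof -
  let ?g = "observable (resolvent_poly z q)" and ?G = "L2_resolvent \<beta> p z (observable q)"
  have "cmod (ev i) \<le> 1" for i using ev_real_pos[of i] ev_real_le_1[of i] by simp
  then have ne: "z \<noteq> ev i" for i using assms by (metis not_le)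
  have "AE \<omega> in \<mu>. z * ?g \<omega> - PF ?g \<omega> = observable q \<omega>"
    using PF_observable[of "resolvent_poly z q"]
  proof eventually_elim
    case (elim \<omega>)
    have "observable (smult z (resolvent_poly z q) - transfer (resolvent_poly z q)) \<omega> = observable q \<omega>"
      using resolvent_poly[OF ne] by simp
    then show ?case using elim by (simp add: observable_def)
  qed
  note g = this
  then have "\<exists>g. g \<in> L2s \<and> (AE \<omega> in \<mu>. z * g \<omega> - PF g \<omega> = observable q \<omega>)"
    using observable_L2 by blast
  from someI_ex[OF this]
  have G: "?G \<in> L2s" "AE \<omega> in \<mu>. z * ?G \<omega> - PF ?G \<omega> = observable q \<omega>"
    unfolding L2_resolvent_def by auto
  then show "?G \<in> L2s" by simp
  let ?d = "\<lambda>\<omega>. ?G \<omega> - ?g \<omega>"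
  have d: "?d \<in> L2s" using G(1) observable_L2 L2_diff by blast
  \<comment> \<open>Values of \<open>PF\<close> are chosen separately for each argument, so
    additivity is obtained only almost everywhere, from the explicit formula.\<close>
  have "AE \<omega> in \<mu>. z * ?d \<omega> = PF ?d \<omega>"
    using g G(2) PF(3)[OF d] PF(3)[OF G(1)] PF(3)[OF observable_L2[of "resolvent_poly z q"]]
    by eventually_elim (simp add: algebra_simps sum_subtractf)
  from resolvent_kernel[OF assms d this] show "AE \<omega> in \<mu>. ?G \<omega> = ?g \<omega>" by simp
qed

subsection \<open>The dual space and the spectral decompositions\<close>

abbreviation XD :: "functional set" where "XD \<equiv> X_dual \<beta> p"

text \<open>Otherwise the monic polynomial with the values of \<open>h\<close> as its roots would
  vanish as an observable. This provides interpolation nodes for every degree.\<close>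

lemma infinite_range_h: "infinite (range (\<lambda>\<omega>. complex_of_real (h \<omega>)))"
proof
  let ?T = "range (\<lambda>\<omega>. complex_of_real (h \<omega>))"
  assume fin: "finite ?T"
  define q where "q = (\<Prod>x\<in>?T. [:- x, 1:])"
  have "observable q \<omega> = 0" for \<omega>
    using fin by (auto simp: observable_def q_def poly_prod intro!: prod_zero)
  then have "q = 0" by (intro observable_AE_0) simp
  then show False using fin by (simp add: q_def)
qed

lemma observable_add: "observable (q + r) = (\<lambda>\<omega>. observable q \<omega> + observable r \<omega>)"
  by (simp add: observable_def)

lemma observable_smult: "observable (smult a q) = (\<lambda>\<omega>. a * observable q \<omega>)"
  by (simp add: observable_def)

lemma antilinear_sum:
  fixes \<nu> :: "complex poly \<Rightarrow> complex"
  assumes add: "\<And>q r. \<nu> (q + r) = \<nu> q + \<nu> r" and smult: "\<And>a q. \<nu> (smult a q) = cnj a * \<nu> q"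
  shows "\<nu> (\<Sum>i\<in>A. smult (a i) (f i)) = (\<Sum>i\<in>A. cnj (a i) * \<nu> (f i))"
proof -
  have "\<nu> 0 = 0" using smult[of 0 0] by simp
  then show ?thesis
    by (induction A rule: infinite_finite_induct) (simp_all add: add smult)
qed

lemma topspace_X_topology: "topspace (X_topology \<beta> p) = Xs"
proof
  show "topspace (X_topology \<beta> p) \<subseteq> Xs"
    using openin_X_topology[of \<beta> p "topspace (X_topology \<beta> p)"] by simp
  have "openin (X_topology \<beta> p) Xs"
    unfolding openin_X_topology by (auto simp: X_def Int_absorb1 UN_upper)
  then show "Xs \<subseteq> topspace (X_topology \<beta> p)" by (rule openin_subset)
qed

text \<open>Lagrange interpolation expresses an anti-linear functional on \<open>X_n\<close> through finitely many
  point evaluations, so continuity is automatic.\<close>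

lemma X_dual_iff:
  "\<phi> \<in> XD \<longleftrightarrow> \<phi> \<in> extensional Xs \<and>
     (\<forall>q r. \<phi> (observable (q + r)) = \<phi> (observable q) + \<phi> (observable r)) \<and>
     (\<forall>a q. \<phi> (observable (smult a q)) = cnj a * \<phi> (observable q))"
proof (intro iffI)
  assume "\<phi> \<in> XD"
  then show "\<phi> \<in> extensional Xs \<and>
     (\<forall>q r. \<phi> (observable (q + r)) = \<phi> (observable q) + \<phi> (observable r)) \<and>
     (\<forall>a q. \<phi> (observable (smult a q)) = cnj a * \<phi> (observable q))"
    by (auto simp: X_dual_def observable_add observable_smult)
next
  assume *: "\<phi> \<in> extensional Xs \<and>
     (\<forall>q r. \<phi> (observable (q + r)) = \<phi> (observable q) + \<phi> (observable r)) \<and>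
     (\<forall>a q. \<phi> (observable (smult a q)) = cnj a * \<phi> (observable q))"
  have "continuous_on (X_n \<beta> p n) \<phi>" for n
  proof -
    obtain T where T: "finite T" "card T = Suc n" "T \<subseteq> range (\<lambda>\<omega>. complex_of_real (h \<omega>))"
      using infinite_arbitrarily_large[OF infinite_range_h] by blast
    \<comment> \<open>Each node is attained by \<open>h\<close> at some sequence \<open>w x\<close>.
      Evaluation of an observable there is a coordinate projection of the function space, hence
      continuous.\<close>
    then have "\<forall>x\<in>T. \<exists>\<omega>. x = complex_of_real (h \<omega>)" by auto
    then obtain w where w: "\<And>x. x \<in> T \<Longrightarrow> complex_of_real (h (w x)) = x" by metis
    have "\<phi> f = (\<Sum>x\<in>T. cnj (f (w x)) * \<phi> (observable (lagrange_basis T x)))" if f: "f \<in> X_n \<beta> p n" for f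
    proof -
      obtain q where q: "f = observable q" "degree q \<le> n" using f by (auto simp: X_n_eq)
      have "q = (\<Sum>x\<in>T. smult (poly q x) (lagrange_basis T x))"
        by (rule lagrange_interpolation) (use T q in auto)
      then have "\<phi> (observable q) = \<phi> (observable (\<Sum>x\<in>T. smult (poly q x) (lagrange_basis T x)))"
        by simp
      also have "\<dots> = (\<Sum>x\<in>T. cnj (poly q x) * \<phi> (observable (lagrange_basis T x)))"
        by (rule antilinear_sum) (use * in auto)
      also have "\<dots> = (\<Sum>x\<in>T. cnj (observable q (w x)) * \<phi> (observable (lagrange_basis T x)))"
        by (intro sum.cong) (auto simp: observable_def w)
      finally show ?thesis by (simp add: q)
    qed
    moreover have "continuous_on (X_n \<beta> p n) (\<lambda>f. \<Sum>x\<in>T. cnj (f (w x)) * \<phi> (observable (lagrange_basis T x)))"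
      by (intro continuous_intros continuous_on_subset[OF continuous_on_product_coordinates]) auto
    ultimately show ?thesis by (simp cong: continuous_on_cong)
  qed
  then have "openin (X_topology \<beta> p) {f \<in> Xs. \<phi> f \<in> U}" if "open U" for U
    unfolding openin_X_topology
  proof (intro conjI allI)
    fix n
    have "{f \<in> Xs. \<phi> f \<in> U} \<inter> X_n \<beta> p n = X_n \<beta> p n \<inter> \<phi> -` U" by (auto simp: X_def)
    then show "openin (top_of_set (X_n \<beta> p n)) ({f \<in> Xs. \<phi> f \<in> U} \<inter> X_n \<beta> p n)"
      using \<open>\<And>n. continuous_on (X_n \<beta> p n) \<phi>\<close> that continuous_openin_preimage_gen by metis
  qed auto
  then have cont: "continuous_map (X_topology \<beta> p) euclidean \<phi>"
    unfolding continuous_map_def topspace_X_topology by auto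
  show "\<phi> \<in> XD"
    unfolding X_dual_def
  proof (intro CollectI conjI ballI allI cont)
    fix f g assume "f \<in> Xs" "g \<in> Xs"
    then obtain q r where "f = observable q" "g = observable r" by (auto simp: X_eq)
    then show "\<phi> (\<lambda>\<omega>. f \<omega> + g \<omega>) = \<phi> f + \<phi> g"
      using * by (simp only: observable_add[symmetric])
  next
    fix a f assume "f \<in> Xs"
    then obtain q where "f = observable q" by (auto simp: X_eq)
    then show "\<phi> (\<lambda>\<omega>. a * f \<omega>) = cnj a * \<phi> f"
      using * by (simp only: observable_smult[symmetric])
  qed (use * in blast)
qed

section \<open>The dual basis and the two decompositions\<close>

lemma X_dual_sum:
  assumes "\<phi> \<in> XD"
  shows "\<phi> (observable (\<Sum>i\<in>A. smult (a i) (f i))) = (\<Sum>i\<in>A. cnj (a i) * \<phi> (observable (f i)))"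
  by (rule antilinear_sum[of "\<lambda>q. \<phi> (observable q)"]) (use assms in \<open>auto simp: X_dual_iff\<close>)

lemma X_dual_expand:
  assumes "\<phi> \<in> XD" "degree q \<le> N"
  shows "\<phi> (observable q) = (\<Sum>i\<le>N. cnj (coord q i) * \<phi> (observable (eigenpoly i)))"
  using X_dual_sum[OF assms(1), of "coord q" eigenpoly "{..N}"] coord_expand[OF assms(2)] by simp

lemma X_dual_eqI:
  assumes "\<phi> \<in> XD" "\<psi> \<in> XD" "\<And>q. \<phi> (observable q) = \<psi> (observable q)"
  shows "\<phi> = \<psi>"
proof (rule extensionalityI[of _ Xs])
  show "\<phi> \<in> extensional Xs" "\<psi> \<in> extensional Xs" using assms by (auto simp: X_dual_iff)
qed (use assms in \<open>auto simp: X_eq\<close>)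

text \<open>The dual consists of anti-linear functionals, hence the conjugate of the coordinate.
  Uniqueness holds because a functional is determined by its values on the eigenpolynomials.\<close>

lemma Phi_dual_eq: "Phi_dual \<beta> p i = (\<lambda>f\<in>Xs. cnj (coord (inv observable f) i))"
  unfolding Phi_dual_def
proof (rule the_equality)
  let ?P = "\<lambda>f\<in>Xs. cnj (coord (inv observable f) i)"
  have P: "?P (observable q) = cnj (coord q i)" for q
    by (simp add: inv_f_f[OF inj_observable])
  have "?P \<in> XD" by (simp only: X_dual_iff P) (simp add: coord_add coord_smult)
  then show "?P \<in> XD \<and> (\<forall>j. ?P (Phi \<beta> p j) = (if i = j then 1 else 0))"
    by (simp only: Phi_eq P coord_eigenpoly) simp
  fix \<phi> assume \<phi>: "\<phi> \<in> XD \<and> (\<forall>j. \<phi> (Phi \<beta> p j) = (if i = j then 1 else 0))"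
  show "\<phi> = ?P"
  proof (rule X_dual_eqI)
    fix q
    \<comment> \<open>The upper limit includes \<open>i\<close> even when it exceeds the degree of
      \<open>q\<close>, so that exactly one summand survives.\<close>
    have "\<phi> (observable q) = (\<Sum>j\<le>max i (degree q). cnj (coord q j) * (if i = j then 1 else 0))"
      using X_dual_expand[of \<phi> q "max i (degree q)"] \<phi> by (simp add: Phi_eq)
    then show "\<phi> (observable q) = ?P (observable q)" unfolding P
      by (simp add: if_distrib[of "\<lambda>x. _ * x"] cong: if_cong)
  qed (use \<phi> \<open>?P \<in> XD\<close> in auto)
qed

lemma Phi_dual_observable: "Phi_dual \<beta> p i (observable q) = cnj (coord q i)"
  by (simp add: Phi_dual_eq inv_f_f[OF inj_observable])

text \<open>Coordinates vanish beyond the degree of the polynomial, so the partial sums are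
  eventually equal to the limit and converge in any topology on the space.\<close>

lemma V_X_decomposition:
  assumes "f \<in> Xs"
  shows "limitin (X_topology \<beta> p)
              (\<lambda>N. \<lambda>\<omega>. \<Sum>i<N. complex_of_real (\<Sum>n<\<beta>. p n ^ (i + 1)) *
                              cnj (Phi_dual \<beta> p i f) * Phi \<beta> p i \<omega>)
              (V_X \<beta> p f) sequentially"
proof (rule limitin_eventually)
  obtain q where q: "f = observable q" using assms by (auto simp: X_eq)
  show "V_X \<beta> p f \<in> topspace (X_topology \<beta> p)" by (simp add: topspace_X_topology q V_X_observable)
  show "\<forall>\<^sub>F N in sequentially. (\<lambda>\<omega>. \<Sum>i<N. complex_of_real (\<Sum>n<\<beta>. p n ^ (i + 1)) *
                              cnj (Phi_dual \<beta> p i f) * Phi \<beta> p i \<omega>) = V_X \<beta> p f"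
    using eventually_gt_at_top[of "degree q"]
  proof eventually_elim
    case (elim N)
    then obtain M where M: "N = Suc M" "degree q \<le> M" by (cases N) auto
    show ?case unfolding q V_X_observable T_expand[OF M(2)] Phi_dual_observable Phi_eq M(1) lessThan_Suc_atMost
      by (simp add: observable_def poly_sum ev_real_def)
  qed
qed

lemma U_cross_observable: "U_cross \<beta> p \<phi> (observable q) = \<phi> (observable (transfer q))"
  by (simp add: U_cross_def V_X_observable)

lemma U_cross_in: "\<phi> \<in> XD \<Longrightarrow> U_cross \<beta> p \<phi> \<in> XD"
  unfolding X_dual_iff U_cross_observable by (simp add: T_add T_smult) (simp add: U_cross_def)

text \<open>At each \<open>f\<close> the partial sums are eventually constant, but from an index
  that depends on \<open>f\<close>, which gives pointwise convergence. As \<open>weak_star\<close>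
  is a subspace topology, the partial sums are also shown to lie in the dual.\<close>

lemma U_cross_decomposition:
  assumes "\<phi> \<in> XD"
  shows "limitin (weak_star \<beta> p)
              (\<lambda>N. \<lambda>f\<in>Xs. \<Sum>i<N. complex_of_real (\<Sum>n<\<beta>. p n ^ (i + 1)) *
                              \<phi> (Phi \<beta> p i) * Phi_dual \<beta> p i f)
              (U_cross \<beta> p \<phi>) sequentially"
proof -
  let ?s = "\<lambda>N. \<lambda>f\<in>Xs. \<Sum>i<N. complex_of_real (\<Sum>n<\<beta>. p n ^ (i + 1)) *
                              \<phi> (Phi \<beta> p i) * Phi_dual \<beta> p i f"
  have s: "?s N (observable q) = (\<Sum>i<N. ev i * \<phi> (observable (eigenpoly i)) * cnj (coord q i))" for N q
    by (simp add: Phi_eq Phi_dual_observable ev_real_def)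
  have "?s N \<in> XD" for N
    by (simp only: X_dual_iff s) (simp add: coord_add coord_smult algebra_simps sum.distrib sum_distrib_left)
  moreover have "(\<lambda>N. ?s N f) \<longlonglongrightarrow> U_cross \<beta> p \<phi> f" if f: "f \<in> Xs" for f
  proof (rule tendsto_eventually)
    obtain q where q: "f = observable q" using f by (auto simp: X_eq)
    show "\<forall>\<^sub>F N in sequentially. ?s N f = U_cross \<beta> p \<phi> f"
      using eventually_gt_at_top[of "degree q"]
    proof eventually_elim
      case (elim N)
      then obtain M where M: "N = Suc M" "degree q \<le> M" by (cases N) auto
      show ?case unfolding q s
        unfolding U_cross_observable T_expand[OF M(2)] X_dual_sum[OF assms] M(1) lessThan_Suc_atMost
        by (simp add: mult_ac)
    qed
  qed
  moreover have "U_cross \<beta> p \<phi> \<in> extensional Xs" by (simp add: U_cross_def)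
  ultimately show ?thesis
    unfolding weak_star_def limitin_subtopology limitin_componentwise
    using U_cross_in[OF assms] by (simp add: PiE_def)
qed

subsection \<open>The generalized resolvent\<close>

text \<open>The eigenvalues are positive, so 0 is not one of them; it is their accumulation point
  and makes the set closed.\<close>

definition spec :: "complex set" where
  "spec = insert 0 (range ev)"

definition gen_resolvent :: "complex \<Rightarrow> obs \<Rightarrow> functional" where
  "gen_resolvent z f = L2_embed \<beta> p (observable (resolvent_poly z (inv observable f)))"

lemma ev_tendsto_0: "ev \<longlonglongrightarrow> 0"
  using tendsto_of_real[OF ev_real_tendsto_0] by simp

lemma closed_spec: "closed spec"
  unfolding spec_def by (rule compact_imp_closed[OF compact_sequence_with_limit[OF ev_tendsto_0]])

lemma spec_subset: "spec \<subseteq> cball 0 1"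
  using ev_real_pos ev_real_le_1 by (auto simp: spec_def less_imp_le)

lemma countable_spec: "countable spec"
  by (simp add: spec_def)

text \<open>A countable set does not disconnect a connected open subset of the plane. This prepares
  the identity theorem.\<close>

lemma connected_diff_spec: "open D \<Longrightarrow> connected D \<Longrightarrow> connected (D - spec)"
  by (rule connected_open_diff_countable) (auto simp: countable_spec)

lemma ev_not_islimpt: "\<not> ev n islimpt spec"
proof
  assume "ev n islimpt spec"
  then have "ev n = 0"
    using sequence_unique_limpt[OF ev_tendsto_0] unfolding spec_def islimpt_insert by blast
  then show False using ev_real_pos[of n] by simp
qed

lemma zero_islimpt: "0 islimpt spec"
  unfolding islimpt_sequential
  by (rule exI[of _ ev]) (use ev_tendsto_0 ev_real_pos in \<open>auto simp: spec_def less_le\<close>)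

section \<open>The continued resolvent and its matrix elements\<close>

lemma inner2_observable_integrable: "integrable \<mu> (\<lambda>\<omega>. observable q \<omega> * cnj (observable r \<omega>))"
  by (intro integrable_L2_mult observable_L2)

lemma L2_embed_observable: "L2_embed \<beta> p g (observable q) = inner2 g (observable q)"
  by (simp add: L2_embed_def)

lemma L2_embed_in:
  assumes "g \<in> L2s"
  shows "L2_embed \<beta> p g \<in> XD"
proof -
  have int: "integrable \<mu> (\<lambda>\<omega>. g \<omega> * cnj (observable q \<omega>))" for q
    by (intro integrable_L2_mult observable_L2 assms)
  have "inner2 g (observable (q + r)) = inner2 g (observable q) + inner2 g (observable r)" for q r
    using Bochner_Integration.integral_add[OF int[of q] int[of r]]
    by (simp add: L2_inner_def observable_add ring_distribs)
  moreover have "inner2 g (observable (smult a q)) = cnj a * inner2 g (observable q)" for a q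
    unfolding L2_inner_def observable_smult by (simp add: mult.left_commute)
  ultimately show ?thesis unfolding X_dual_iff L2_embed_observable by (simp add: L2_embed_def)
qed

lemma inner2_sum_left:
  "inner2 (observable (\<Sum>i\<in>A. smult (a i) (f i))) (observable r) =
     (\<Sum>i\<in>A. a i * inner2 (observable (f i)) (observable r))"
proof -
  have "inner2 (observable (\<Sum>i\<in>A. smult (a i) (f i))) (observable r) =
      (\<integral>\<omega>. (\<Sum>i\<in>A. a i * (observable (f i) \<omega> * cnj (observable r \<omega>))) \<partial>\<mu>)"
    by (simp add: L2_inner_def observable_def poly_sum sum_distrib_right mult.assoc)
  also have "\<dots> = (\<Sum>i\<in>A. a i * inner2 (observable (f i)) (observable r))"
    unfolding L2_inner_def
    by (subst Bochner_Integration.integral_sum)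
      (simp_all only: integral_mult_right_zero integrable_mult_right inner2_observable_integrable)
  finally show ?thesis .
qed

lemma gen_resolvent_observable:
  "gen_resolvent z (observable q) (observable r) =
     (\<Sum>i\<le>degree q. coord q i / (z - ev i) * inner2 (observable (eigenpoly i)) (observable r))"
  unfolding gen_resolvent_def L2_embed_observable resolvent_poly_def inv_f_f[OF inj_observable]
  by (rule inner2_sum_left)

lemma gen_resolvent_holomorphic: "weakly_holomorphic_on \<beta> p gen_resolvent (- spec)"
  unfolding weakly_holomorphic_on_def
proof (intro conjI ballI)
  show "gen_resolvent z f \<in> XD" for z f
    unfolding gen_resolvent_def by (intro L2_embed_in observable_L2)
  fix f \<phi> assume "f \<in> Xs" "\<phi> \<in> Xs"
  then obtain q r where "f = observable q" "\<phi> = observable r" by (auto simp: X_eq)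
  then show "(\<lambda>z. gen_resolvent z f \<phi>) holomorphic_on - spec"
    by (simp only: gen_resolvent_observable) (auto intro!: holomorphic_intros simp: spec_def)
qed

lemma gen_resolvent_outside:
  assumes "cmod z > 1" "f \<in> Xs"
  shows "gen_resolvent z f = L2_embed \<beta> p (L2_resolvent \<beta> p z f)"
proof -
  obtain q where q: "f = observable q" using assms(2) by (auto simp: X_eq)
  note res = L2_resolvent_observable[OF assms(1), of q]
  show ?thesis
    unfolding gen_resolvent_def q inv_f_f[OF inj_observable]
  proof (rule X_dual_eqI[OF L2_embed_in[OF observable_L2] L2_embed_in[OF res(1)]])
    fix r
    show "L2_embed \<beta> p (observable (resolvent_poly z q)) (observable r) =
        L2_embed \<beta> p (L2_resolvent \<beta> p z (observable q)) (observable r)"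
      unfolding L2_embed_observable
      by (rule inner2_cong_AE[symmetric]) (intro res observable_L2)+
  qed
qed

text \<open>The squared norm of the eigenfunction, which is the residue at \<open>ev n\<close> of
  the corresponding diagonal matrix element of the resolvent.\<close>

definition eigen_norm :: "nat \<Rightarrow> complex" where
  "eigen_norm n = inner2 (observable (eigenpoly n)) (observable (eigenpoly n))"

lemma eigen_norm_nonzero: "eigen_norm n \<noteq> 0"
proof
  assume "eigen_norm n = 0"
  then have "eigenpoly n = 0"
    unfolding eigen_norm_def by (intro observable_AE_0 inner2_self_0 observable_L2)
  then show False using eigenpoly(2)[of n] by simp
qed

text \<open>The coordinates of an eigenpolynomial form a unit vector, so this matrix element sees a
  single pole, without any orthogonality of the eigenfunctions.\<close>

lemma gen_resolvent_eigenpoly: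
  "gen_resolvent z (observable (eigenpoly n)) (observable (eigenpoly n)) = eigen_norm n / (z - ev n)"
proof -
  have "degree (eigenpoly n) = n"
    using eigenpoly(1)[of n] le_degree[of "eigenpoly n" n] eigenpoly(2)[of n] by simp
  then have "gen_resolvent z (observable (eigenpoly n)) (observable (eigenpoly n)) =
      (\<Sum>i\<le>n. if i = n then eigen_norm n / (z - ev n) else 0)"
    unfolding gen_resolvent_observable coord_eigenpoly eigen_norm_def
    by (intro sum.cong) auto
  then show ?thesis by simp
qed

text \<open>Near \<open>ev n\<close> the product \<open>(z - ev n) * G z\<close> is the nonzero
  constant \<open>eigen_norm n\<close>, while continuity of \<open>G\<close> would make it tend to
  0.\<close>

lemma no_holomorphic_extension:
  assumes "open D" "ev n \<in> D" "G holomorphic_on D"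
    and eq: "\<And>z. z \<in> D - spec \<Longrightarrow>
      G z = gen_resolvent z (observable (eigenpoly n)) (observable (eigenpoly n))"
  shows False
proof -
  have "continuous_on D G" by (rule holomorphic_on_imp_continuous_on) fact
  then have "G \<midarrow>ev n\<rightarrow> G (ev n)"
    using assms(1,2) by (simp add: continuous_on_eq_continuous_at isCont_def)
  then have "(\<lambda>z. (z - ev n) * G z) \<midarrow>ev n\<rightarrow> (ev n - ev n) * G (ev n)"
    by (intro tendsto_intros)
  moreover have "\<forall>\<^sub>F z in at (ev n). (z - ev n) * G z = eigen_norm n"
  proof -
    have "\<forall>\<^sub>F z in at (ev n). z \<notin> spec"
      using ev_not_islimpt[of n] by (simp add: islimpt_iff_eventually)
    moreover have "\<forall>\<^sub>F z in at (ev n). z \<in> D"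
      using assms(1,2) by (rule eventually_at_in_open')
    ultimately show ?thesis using eventually_neq_at_within[of "ev n" "ev n" UNIV]
      by eventually_elim (simp add: eq gen_resolvent_eigenpoly)
  qed
  then have "(\<lambda>z. (z - ev n) * G z) \<midarrow>ev n\<rightarrow> eigen_norm n"
    by (rule tendsto_eventually)
  ultimately have "eigen_norm n = (ev n - ev n) * G (ev n)"
    using LIM_unique by blast
  then show False using eigen_norm_nonzero[of n] by simp
qed

lemma generalized_resolvent_exists: "generalized_resolvent \<beta> p gen_resolvent spec"
  unfolding generalized_resolvent_def
proof (intro conjI ballI allI impI notI)
  show "connected (- spec)"
    using connected_diff_spec[of UNIV] by (simp add: Compl_eq_Diff_UNIV connected_UNIV)
  fix s assume s: "s \<in> spec"
    and "\<exists>r>0. \<exists>F. weakly_holomorphic_on \<beta> p F (ball s r) \<and>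
        (\<forall>z\<in>ball s r - spec. \<forall>f\<in>Xs. F z f = gen_resolvent z f)"
  then obtain r F where r: "r > 0" and F: "weakly_holomorphic_on \<beta> p F (ball s r)"
    "\<And>z f. z \<in> ball s r - spec \<Longrightarrow> f \<in> Xs \<Longrightarrow> F z f = gen_resolvent z f" by blast
  \<comment> \<open>The point 0 carries no pole of its own; an extension around it would also extend
    across the eigenvalues nearby.\<close>
  have "\<exists>n. ev n \<in> ball s r"
  proof (cases "s = 0")
    case True
    have "\<forall>\<^sub>F n in sequentially. ev n \<in> ball 0 r"
      by (rule topological_tendstoD[OF ev_tendsto_0]) (use r in auto)
    then show ?thesis using True by (auto simp: eventually_sequentially)
  next
    case False
    then obtain n where "s = ev n" using s by (auto simp: spec_def)
    then have "ev n \<in> ball s r" using r by simp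
    then show ?thesis ..
  qed
  then obtain n where n: "ev n \<in> ball s r" ..
  show False
    by (rule no_holomorphic_extension[of "ball s r" n
          "\<lambda>z. F z (observable (eigenpoly n)) (observable (eigenpoly n))"])
      (use n F in \<open>auto simp: weakly_holomorphic_on_def\<close>)
qed (simp_all add: closed_spec spec_subset gen_resolvent_holomorphic gen_resolvent_outside)

text \<open>Off both singular sets the two continuations agree by the identity theorem, starting
  from the exterior of the unit disc. A point of \<open>S\<close> outside \<open>spec\<close> would
  then be removable by \<open>gen_resolvent\<close>; conversely the poles lie in \<open>S\<close>,
  and so does their limit 0 because \<open>S\<close> is closed.\<close>

lemma generalized_resolvent_unique:
  assumes gr: "generalized_resolvent \<beta> p R S"
  shows "S = spec" and "\<And>z f. z \<notin> spec \<Longrightarrow> f \<in> Xs \<Longrightarrow> R z f = gen_resolvent z f"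
proof -
  have S: "closed S" "S \<subseteq> cball 0 1" "connected (- S)" "weakly_holomorphic_on \<beta> p R (- S)"
    and out: "\<And>z f. cmod z > 1 \<Longrightarrow> f \<in> Xs \<Longrightarrow> R z f = L2_embed \<beta> p (L2_resolvent \<beta> p z f)"
    and sing: "\<And>s r F. s \<in> S \<Longrightarrow> r > 0 \<Longrightarrow> weakly_holomorphic_on \<beta> p F (ball s r) \<Longrightarrow>
       \<exists>z\<in>ball s r - S. \<exists>f\<in>Xs. F z f \<noteq> R z f"
    using gr unfolding generalized_resolvent_def by blast+
  define D where "D = - S - spec"
  have D: "open D" "connected D"
    using S(1,3) closed_spec connected_diff_spec[of "- S"] by (auto simp: D_def open_Diff)
  have hol: "weakly_holomorphic_on \<beta> p R D" "weakly_holomorphic_on \<beta> p gen_resolvent D"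
    by (rule weakly_holomorphic_on_subset[OF S(4)] weakly_holomorphic_on_subset[OF gen_resolvent_holomorphic];
        force simp: D_def)+
  have eq: "R z f = gen_resolvent z f" if z: "z \<in> D" and f: "f \<in> Xs" for z f
  proof (rule X_dual_eqI)
    show "R z f \<in> XD" "gen_resolvent z f \<in> XD"
      using z f hol by (auto simp: weakly_holomorphic_on_def)
    fix q
    show "R z f (observable q) = gen_resolvent z f (observable q)"
    proof (rule analytic_continuation_open[where s = "- cball 0 1" and s' = D
          and f = "\<lambda>z. R z f (observable q)" and g = "\<lambda>z. gen_resolvent z f (observable q)"])
      show "- cball 0 1 \<noteq> ({} :: complex set)"
        by (auto simp: set_eq_iff intro!: exI[of _ 2])
      show "- cball 0 1 \<subseteq> D" using S(2) spec_subset by (auto simp: D_def)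
      show "(\<lambda>z. R z f (observable q)) holomorphic_on D"
        "(\<lambda>z. gen_resolvent z f (observable q)) holomorphic_on D"
        using hol f by (auto simp: weakly_holomorphic_on_def)
      show "R z f (observable q) = gen_resolvent z f (observable q)" if "z \<in> - cball 0 1" for z
        using that f by (simp add: out gen_resolvent_outside)
    qed (use D z in auto)
  qed
  have "S \<subseteq> spec"
  proof
    fix s assume s: "s \<in> S"
    show "s \<in> spec"
    proof (rule ccontr)
      assume "s \<notin> spec"
      then obtain r where r: "r > 0" "ball s r \<subseteq> - spec"
        using closed_spec open_contains_ball[of "- spec"] by auto
      then have "weakly_holomorphic_on \<beta> p gen_resolvent (ball s r)"
        by (intro weakly_holomorphic_on_subset[OF gen_resolvent_holomorphic])
      from sing[OF s r(1) this] obtain z f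
        where "z \<in> ball s r - S" "f \<in> Xs" "gen_resolvent z f \<noteq> R z f" by blast
      then show False using eq[of z f] r(2) by (auto simp: D_def)
    qed
  qed
  moreover have "ev n \<in> S" for n
  proof (rule ccontr)
    assume "ev n \<notin> S"
    then show False
      by (intro no_holomorphic_extension[of "- S" n
            "\<lambda>z. R z (observable (eigenpoly n)) (observable (eigenpoly n))"])
        (use S(1,4) eq in \<open>auto simp: weakly_holomorphic_on_def D_def\<close>)
  qed
  moreover have "0 \<in> S"
    using closed_sequentially[OF S(1) _ ev_tendsto_0] \<open>\<And>n. ev n \<in> S\<close> by blast
  ultimately show "S = spec" by (auto simp: spec_def)
  then show "R z f = gen_resolvent z f" if "z \<notin> spec" "f \<in> Xs" for z f
    using eq that by (auto simp: D_def)
qed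

section \<open>Contour integrals and the generalized eigenvalues\<close>

lemma encircling_exists: "\<exists>\<gamma>. encircles_only \<gamma> spec (ev n)"
proof -
  have "\<forall>\<^sub>F z in at (ev n). z \<notin> spec"
    using ev_not_islimpt[of n] by (simp add: islimpt_iff_eventually)
  then obtain d where d: "d > 0" "\<And>z. z \<noteq> ev n \<Longrightarrow> dist z (ev n) < d \<Longrightarrow> z \<notin> spec"
    unfolding eventually_at by auto
  \<comment> \<open>Half of the isolation radius keeps the circle off \<open>spec\<close> and every
    other point of \<open>spec\<close> outside the closed disc. Existence of one such curve
    validates the choice made in \<open>riesz_projection\<close>.\<close>
  let ?\<gamma> = "circlepath (ev n) (d / 2)"
  have "path_image ?\<gamma> \<subseteq> - spec"
    using d by (auto simp: dist_commute)
  moreover have "winding_number ?\<gamma> s = 0" if "s \<in> spec - {ev n}" for s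
    by (rule winding_number_zero_outside[of _ "cball (ev n) (d / 2)"])
      (use that d in \<open>auto simp: dist_commute not_le not_less\<close>, fastforce simp: dist_commute)
  moreover have "winding_number ?\<gamma> (ev n) = 1"
    using d(1) by (intro winding_number_circlepath_centre) simp
  ultimately have "encircles_only ?\<gamma> spec (ev n)"
    using d(1) by (simp add: encircles_only_def simple_path_circlepath)
  then show ?thesis by blast
qed

text \<open>On any admissible curve the integrand is a simple pole with residue
  \<open>eigen_norm n\<close>, and winding number 1 extracts that residue. One nonzero value
  suffices to produce a generalized eigenvector.\<close>

lemma riesz_projection_eigenpoly:
  assumes gr: "generalized_resolvent \<beta> p R spec"
  shows "riesz_projection \<beta> p R spec (ev n) (observable (eigenpoly n)) (observable (eigenpoly n))
    = eigen_norm n"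
proof -
  define \<gamma> where "\<gamma> = (SOME \<gamma>. encircles_only \<gamma> spec (ev n))"
  have "encircles_only \<gamma> spec (ev n)"
    unfolding \<gamma>_def using encircling_exists by (rule someI_ex)
  then have \<gamma>: "valid_path \<gamma>" "path_image \<gamma> \<subseteq> - spec" "winding_number \<gamma> (ev n) = 1"
    by (auto simp: encircles_only_def)
  have notin: "ev n \<notin> path_image \<gamma>" using \<gamma>(2) by (auto simp: spec_def)
  let ?E = "observable (eigenpoly n)"
  have "contour_integral \<gamma> (\<lambda>z. R z ?E ?E) = contour_integral \<gamma> (\<lambda>z. eigen_norm n * (1 / (z - ev n)))"
  proof (rule contour_integral_eq)
    fix z assume "z \<in> path_image \<gamma>"
    then have "z \<notin> spec" using \<gamma>(2) by blast
    then show "R z ?E ?E = eigen_norm n * (1 / (z - ev n))"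
      using generalized_resolvent_unique(2)[OF gr, of z ?E] by (simp add: gen_resolvent_eigenpoly)
  qed
  also have "\<dots> = eigen_norm n * (2 * of_real pi * \<i>)"
    using has_contour_integral_lmul[OF has_contour_integral_winding_number[OF \<gamma>(1) notin], of "eigen_norm n"]
    by (intro contour_integral_unique) (simp add: \<gamma>(3))
  finally show ?thesis
    unfolding riesz_projection_def Let_def \<gamma>_def[symmetric] by simp
qed

text \<open>Every \<open>ev n\<close> is isolated and has a nonzero Riesz projection, whereas 0 is
  excluded as a limit point of the singular set.\<close>

lemma generalized_eigenvalues_eq:
  assumes gr: "generalized_resolvent \<beta> p R S"
  shows "generalized_eigenvalues \<beta> p R S = range ev"
proof -
  note S = generalized_resolvent_unique(1)[OF gr]
  note gr' = gr[unfolded S]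
  have "generalized_eigenvectors \<beta> p R spec (ev n) \<noteq> {}" for n
  proof -
    let ?E = "observable (eigenpoly n)"
    have "riesz_projection \<beta> p R spec (ev n) ?E \<noteq> (\<lambda>\<phi>\<in>Xs. 0)"
      using riesz_projection_eigenpoly[OF gr', of n] eigen_norm_nonzero[of n]
      by (metis observable_in_X restrict_apply')
    then show ?thesis unfolding generalized_eigenvectors_def by (blast intro: observable_in_X)
  qed
  then show ?thesis
    unfolding generalized_eigenvalues_def S
    using ev_not_islimpt zero_islimpt by (auto simp: spec_def)
qed

end

theorem theorem3p12:
  fixes \<beta> :: nat and p :: "nat \<Rightarrow> real"
  assumes "2 \<le> \<beta>"
    and "\<And>i. i < \<beta> \<Longrightarrow> 0 < p i"
    and "(\<Sum>i<\<beta>. p i) = 1"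
  shows "(\<exists>R S. generalized_resolvent \<beta> p R S) \<and>
         (\<forall>R S. generalized_resolvent \<beta> p R S \<longrightarrow>
            generalized_eigenvalues \<beta> p R S =
              {complex_of_real (\<Sum>i<\<beta>. p i ^ (n + 1)) | n. True}) \<and>
         (\<forall>f\<in>X \<beta> p.
            limitin (X_topology \<beta> p)
              (\<lambda>N. \<lambda>\<omega>. \<Sum>i<N. complex_of_real (\<Sum>n<\<beta>. p n ^ (i + 1)) *
                              cnj (Phi_dual \<beta> p i f) * Phi \<beta> p i \<omega>)
              (V_X \<beta> p f) sequentially) \<and>
         (\<forall>\<mu>\<in>X_dual \<beta> p.
            limitin (weak_star \<beta> p)
              (\<lambda>N. \<lambda>f\<in>X \<beta> p. \<Sum>i<N. complex_of_real (\<Sum>n<\<beta>. p n ^ (i + 1)) *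
                              \<mu> (Phi \<beta> p i) * Phi_dual \<beta> p i f)
              (U_cross \<beta> p \<mu>) sequentially)"
proof -
  interpret bernoulli_weights \<beta> p
    using assms by unfold_locales
  have "range ev = {complex_of_real (\<Sum>i<\<beta>. p i ^ (n + 1)) | n. True}"
    unfolding ev_real_def by blast
  then show ?thesis
    using generalized_resolvent_exists generalized_eigenvalues_eq V_X_decomposition
      U_cross_decomposition by blast
qed

end
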